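(* Let $\beta>0$, $\theta_{\rm left}\in\mathbb R$, $n\ge1$, and consider the system of $n$ interacting random walkers on $\mathbb Z+\frac12$ described in the context, started from an arbitrary fixed (deterministic) initial configuration. Let $W(t)\ge0$ be the difference between the positions of the rightmost and the leftmost walker at time $t$ (the width of the shock). Then the moments of $W(t)$ are bounded in time: for every $p\ge1$, $$\sup_{t\ge0}\mathbf E\left[W(t)^p\right]<\infty .$$
   Context: The walkers represent the shocks of size one in the exponential bricklayers' model with parameter $\beta$ and are defined as follows. $n$ walkers live on $\mathbb Z+\frac12$ (several may occupy the same site) and evolve as a continuous-time Markov jump process in which one walker at a time jumps to a nearest-neighbor site. If at a given moment a site is occupied by $m>0$ walkers and there are exactly $k$ walkers strictly to the left of that site, then, independently for the different occupied sites, one walker jumps from this site - to its right neighbor with rate $e^{\theta_{\rm left}-k\beta}\left(1-e^{-m\beta}\right)$, and - to its left neighbor with rate $e^{-\theta_{\rm left}+k\beta}\left(e^{m\beta}-1\right)$. *)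

theory Defs
  imports "HOL-Probability.Probability" "HOL-Library.Multiset"
begin

section \<open>Markov jump processes on a countable state space\<close>

text \<open>
  \<open>q x y\<close> is the rate of the jump from \<open>x\<close> to \<open>y\<close>, for \<open>x \<noteq> y\<close>; diagonal values of \<open>q\<close> are never
  used. The last two clauses say \<open>p h x y = q x y * h + o(h)\<close> for \<open>x \<noteq> y\<close> and
  \<open>p h x x = 1 - (\<Sum>y\<noteq>x. q x y) * h + o(h)\<close>.
\<close>

definition transition_function ::
    "'s set \<Rightarrow> ('s \<Rightarrow> 's \<Rightarrow> real) \<Rightarrow> (real \<Rightarrow> 's \<Rightarrow> 's \<Rightarrow> real) \<Rightarrow> bool" where
  "transition_function S q p \<longleftrightarrow>
     (\<forall>t\<ge>0. \<forall>x\<in>S. \<forall>y\<in>S. 0 \<le> p t x y) \<and>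
     (\<forall>t\<ge>0. \<forall>x\<in>S. ((\<lambda>y. p t x y) has_sum 1) S) \<and>
     (\<forall>x\<in>S. \<forall>y\<in>S. p 0 x y = (if x = y then 1 else 0)) \<and>
     (\<forall>s\<ge>0. \<forall>t\<ge>0. \<forall>x\<in>S. \<forall>y\<in>S. ((\<lambda>z. p s x z * p t z y) has_sum p (s + t) x y) S) \<and>
     (\<forall>x\<in>S. \<forall>y\<in>S. x \<noteq> y \<longrightarrow> ((\<lambda>h. p h x y / h) \<longlongrightarrow> q x y) (at_right 0)) \<and>
     (\<forall>x\<in>S. \<exists>r. ((\<lambda>y. q x y) has_sum r) (S - {x}) \<and>
                 ((\<lambda>h. (1 - p h x x) / h) \<longlongrightarrow> r) (at_right 0))"

definition past_events ::
    "'w measure \<Rightarrow> 's set \<Rightarrow> (real \<Rightarrow> 'w \<Rightarrow> 's) \<Rightarrow> real \<Rightarrow> 'w set set" where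
  "past_events M S X s =
     sigma_sets (space M) {X u -` {x} \<inter> space M | u x. 0 \<le> u \<and> u \<le> s \<and> x \<in> S}"

text \<open>
  The Markov property \<open>P(X (s + t) = y | F s) = p t (X s) y\<close> is written out on the events
  \<open>A \<inter> {X s = x}\<close> with \<open>A\<close> in the natural filtration \<open>F s\<close>; no conditioning on null events occurs.
  In the discrete topology, paths that are right-continuous with left limits are exactly the
  right-continuous step functions with finitely many jumps in every bounded time interval.
\<close>

definition markov_jump_process ::
    "'w measure \<Rightarrow> 's set \<Rightarrow> ('s \<Rightarrow> 's \<Rightarrow> real) \<Rightarrow> 's \<Rightarrow> (real \<Rightarrow> 'w \<Rightarrow> 's) \<Rightarrow> bool" where
  "markov_jump_process M S q x0 X \<longleftrightarrow>
     prob_space M \<and>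
     (\<forall>t\<ge>0. X t \<in> measurable M (count_space S)) \<and>
     (AE \<omega> in M. X 0 \<omega> = x0) \<and>
     (\<exists>p. transition_function S q p \<and>
        (\<forall>s\<ge>0. \<forall>t\<ge>0. \<forall>A\<in>past_events M S X s. \<forall>x\<in>S. \<forall>y\<in>S.
           measure M {\<omega> \<in> A. X s \<omega> = x \<and> X (s + t) \<omega> = y}
             = measure M {\<omega> \<in> A. X s \<omega> = x} * p t x y)) \<and>
     (AE \<omega> in M.
        (\<forall>t\<ge>0. \<forall>\<^sub>F s in at_right t. X s \<omega> = X t \<omega>) \<and>
        (\<forall>t>0. \<exists>x. \<forall>\<^sub>F s in at_left t. X s \<omega> = x))"


section \<open>The interacting walkers\<close>

definition half_integers :: "real set" where
  "half_integers = range (\<lambda>z::int. of_int z + 1 / 2)"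

text \<open>A configuration is the multiset of the walkers' positions: the dynamics does not
  distinguish between walkers at the same site.\<close>

definition configurations :: "nat \<Rightarrow> real multiset set" where
  "configurations n = {c. size c = n \<and> set_mset c \<subseteq> half_integers}"

definition walkers_left_of :: "real multiset \<Rightarrow> real \<Rightarrow> nat" where
  "walkers_left_of c i = size {#j \<in># c. j < i#}"

definition right_rate :: "real \<Rightarrow> real \<Rightarrow> real multiset \<Rightarrow> real \<Rightarrow> real" where
  "right_rate \<beta> \<theta> c i =
     exp (\<theta> - real (walkers_left_of c i) * \<beta>) * (1 - exp (- real (count c i) * \<beta>))"

definition left_rate :: "real \<Rightarrow> real \<Rightarrow> real multiset \<Rightarrow> real \<Rightarrow> real" where
  "left_rate \<beta> \<theta> c i =
     exp (- \<theta> + real (walkers_left_of c i) * \<beta>) * (exp (real (count c i) * \<beta>) - 1)"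

definition move_walker :: "real multiset \<Rightarrow> real \<Rightarrow> real \<Rightarrow> real multiset" where
  "move_walker c i j = c - {#i#} + {#j#}"

text \<open>Independent jump clocks at the occupied sites: the rate of a transition is the sum of the
  rates of the individual jumps that produce it.\<close>

definition walker_rate :: "real \<Rightarrow> real \<Rightarrow> real multiset \<Rightarrow> real multiset \<Rightarrow> real" where
  "walker_rate \<beta> \<theta> c c' =
     (\<Sum>i\<in>set_mset c.
        (if c' = move_walker c i (i + 1) then right_rate \<beta> \<theta> c i else 0) +
        (if c' = move_walker c i (i - 1) then left_rate \<beta> \<theta> c i else 0))"

definition width :: "real multiset \<Rightarrow> real" where
  "width c = Max (set_mset c) - Min (set_mset c)"

end

theory Submission
  imports Defs
begin

text \<open>
  List the positions in increasing order and look at a single gap between consecutive walkers.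
  A positive gap narrows at least \<open>exp \<beta>\<close> times as fast as it widens, whatever the other walkers do,
  so the sum over all gaps of \<open>exp (\<beta> / 2 * gap)\<close> is a Foster--Lyapunov function and dominates
  every power of the width. The total jump rate out of a configuration is bounded, hence on a short
  time interval \<open>h\<close> the transition function agrees with \<open>I + h Q\<close> up to \<open>O(h\<^sup>2)\<close> uniformly in the state;
  iterating this on truncations of the Lyapunov function replaces the construction
  of the semigroup.
\<close>

section \<open>Lyapunov bounds for jump processes with bounded rates\<close>

text \<open>The transition function is given only through its derivative at time 0, state by state,
  and \<open>f\<close> is unbounded, so its mean at time \<open>t\<close> is not known to be finite,
  let alone differentiable. One-sidedness circumvents both: an upper bound on the mean of
  \<open>min f N\<close> is a lower bound on the mean of \<open>w = max 0 (N - f)\<close>. As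
  \<open>w\<close> is nonnegative, any part of the semigroup may be dropped. Hence only lower bounds
  on \<open>p h x x\<close> and on \<open>p h x y\<close> for finitely many jump targets
  \<open>y\<close> are needed, and Chapman-Kolmogorov on ever finer grids supplies them. The
  semigroup acts on the bounded \<open>w\<close>, while the drift inequality is applied to the
  untruncated \<open>f\<close>, which enters through comparison functions \<open>B - r * f\<close>;
  so truncation never disturbs the drift. The errors are proportional to \<open>N\<close>, which
  fixes the order of limits: mesh to 0 first, then \<open>N\<close> to infinity.\<close>

lemma transition_functionD:
  assumes "transition_function S q p"
  shows transition_nonneg: "\<And>t x y. t \<ge> 0 \<Longrightarrow> x \<in> S \<Longrightarrow> y \<in> S \<Longrightarrow> 0 \<le> p t x y"
    and transition_has_sum: "\<And>t x. t \<ge> 0 \<Longrightarrow> x \<in> S \<Longrightarrow> ((\<lambda>y. p t x y) has_sum 1) S"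
    and transition_0: "\<And>x y. x \<in> S \<Longrightarrow> y \<in> S \<Longrightarrow> p 0 x y = (if x = y then 1 else 0)"
    and chapman_kolmogorov: "\<And>s t x y. s \<ge> 0 \<Longrightarrow> t \<ge> 0 \<Longrightarrow> x \<in> S \<Longrightarrow> y \<in> S \<Longrightarrow>
          ((\<lambda>z. p s x z * p t z y) has_sum p (s + t) x y) S"
    and transition_rate: "\<And>x y. x \<in> S \<Longrightarrow> y \<in> S \<Longrightarrow> x \<noteq> y \<Longrightarrow>
          ((\<lambda>h. p h x y / h) \<longlongrightarrow> q x y) (at_right 0)"
    and transition_exit_rate: "\<And>x. x \<in> S \<Longrightarrow> \<exists>r. ((\<lambda>y. q x y) has_sum r) (S - {x}) \<and>
          ((\<lambda>h. (1 - p h x x) / h) \<longlongrightarrow> r) (at_right 0)"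
proof -
  note D = assms[unfolded transition_function_def]
  note D1 = conjunct2[OF D] note D2 = conjunct2[OF D1] note D3 = conjunct2[OF D2]
  note D4 = conjunct2[OF D3]
  show "\<And>t x y. t \<ge> 0 \<Longrightarrow> x \<in> S \<Longrightarrow> y \<in> S \<Longrightarrow> 0 \<le> p t x y"
    using conjunct1[OF D] by simp
  show "\<And>t x. t \<ge> 0 \<Longrightarrow> x \<in> S \<Longrightarrow> ((\<lambda>y. p t x y) has_sum 1) S"
    using conjunct1[OF D1] by simp
  show "\<And>x y. x \<in> S \<Longrightarrow> y \<in> S \<Longrightarrow> p 0 x y = (if x = y then 1 else 0)"
    using conjunct1[OF D2] by simp
  show "\<And>s t x y. s \<ge> 0 \<Longrightarrow> t \<ge> 0 \<Longrightarrow> x \<in> S \<Longrightarrow> y \<in> S \<Longrightarrow>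
      ((\<lambda>z. p s x z * p t z y) has_sum p (s + t) x y) S"
    using conjunct1[OF D3] by simp
  show "\<And>x y. x \<in> S \<Longrightarrow> y \<in> S \<Longrightarrow> x \<noteq> y \<Longrightarrow> ((\<lambda>h. p h x y / h) \<longlongrightarrow> q x y) (at_right 0)"
    using conjunct1[OF D4] by simp
  show "\<And>x. x \<in> S \<Longrightarrow> \<exists>r. ((\<lambda>y. q x y) has_sum r) (S - {x}) \<and>
      ((\<lambda>h. (1 - p h x x) / h) \<longlongrightarrow> r) (at_right 0)"
    using conjunct2[OF D4] by simp
qed

lemma filterlim_divide_of_nat_at_right_0:
  fixes h :: real
  assumes "h > 0"
  shows "filterlim (\<lambda>m. h / real m) (at_right 0) sequentially"
  unfolding filterlim_at
proof
  show "((\<lambda>m. h / real m) \<longlongrightarrow> 0) sequentially"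
    by (intro real_tendsto_divide_at_top[OF tendsto_const] filterlim_real_sequentially)
  show "\<forall>\<^sub>F m in sequentially. h / real m \<in> {0<..} \<and> h / real m \<noteq> 0"
    using assms by (intro eventually_sequentiallyI[of 1]) auto
qed

lemma has_sum_finite_sum:
  fixes g :: "'i \<Rightarrow> 'a \<Rightarrow> 'b :: topological_comm_monoid_add"
  assumes "finite F" "\<And>i. i \<in> F \<Longrightarrow> (g i has_sum s i) A"
  shows "((\<lambda>x. \<Sum>i\<in>F. g i x) has_sum (\<Sum>i\<in>F. s i)) A"
  using assms by (induction F rule: finite_induct) (auto intro!: has_sum_add)

section \<open>Finite-time lower bounds from the derivative at time 0\<close>

context
  fixes S :: "'s set" and q :: "'s \<Rightarrow> 's \<Rightarrow> real" and p :: "real \<Rightarrow> 's \<Rightarrow> 's \<Rightarrow> real"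
  assumes tf: "transition_function S q p"
begin

lemma chapman_kolmogorov_finite:
  assumes "s \<ge> 0" "t \<ge> 0" "x \<in> S" "y \<in> S" "finite F" "F \<subseteq> S"
  shows "(\<Sum>z\<in>F. p s x z * p t z y) \<le> p (s + t) x y"
  by (rule finite_sum_le_has_sum[OF chapman_kolmogorov[OF tf assms(1-4)]])
    (use assms in \<open>auto intro!: mult_nonneg_nonneg transition_nonneg[OF tf]\<close>)

text \<open>Being at \<open>x\<close> at every point of the grid is one of the ways to be at
  \<open>x\<close> at its end.\<close>

lemma transition_diag_power:
  assumes "h \<ge> 0" "x \<in> S"
  shows "p h x x ^ m \<le> p (real m * h) x x"
proof (induction m)
  case 0
  then show ?case using transition_0[OF tf] assms by simp
next
  case (Suc m)
  have "p h x x ^ Suc m \<le> p h x x * p (real m * h) x x"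
    using Suc transition_nonneg[OF tf] assms by (simp add: mult_left_mono)
  also have "\<dots> \<le> p (h + real m * h) x x"
    using chapman_kolmogorov_finite[of h "real m * h" x x "{x}"] assms by simp
  finally show ?case by (simp add: algebra_simps)
qed

text \<open>Cut \<open>[0, h]\<close> into \<open>m\<close> pieces. Bernoulli's inequality bounds
  the power \<open>p (h / m) x x ^ m\<close> below by an expression linear in
  \<open>p (h / m) x x - 1\<close>, and the derivative at 0 gives its limit. No error term
  survives.\<close>

lemma transition_diag_ge:
  assumes x: "x \<in> S" and r: "((\<lambda>y. q x y) has_sum r) (S - {x})" and h: "h \<ge> 0"
  shows "1 - r * h \<le> p h x x"
proof (cases "h = 0")
  case True
  then show ?thesis using transition_0[OF tf x x] by simp
next
  case False
  with h have h: "h > 0" by simp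
  obtain r' where r': "((\<lambda>y. q x y) has_sum r') (S - {x})"
    and lim: "((\<lambda>h. (1 - p h x x) / h) \<longlongrightarrow> r') (at_right 0)"
    using transition_exit_rate[OF tf x] by blast
  have "r' = r" using has_sum_unique[OF r' r] .
  note lim = lim[unfolded this]
  have "((\<lambda>m. 1 - (1 - p (h / real m) x x) / (h / real m) * h) \<longlongrightarrow> 1 - r * h) sequentially"
    by (intro tendsto_intros filterlim_compose[OF lim filterlim_divide_of_nat_at_right_0] h)
  then show ?thesis
  proof (rule tendsto_upperbound)
    show "\<forall>\<^sub>F m in sequentially.
        1 - (1 - p (h / real m) x x) / (h / real m) * h \<le> p h x x"
    proof (rule eventually_sequentiallyI[of 1])
      fix m :: nat assume m: "1 \<le> m"
      let ?d = "p (h / real m) x x"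
      have "1 - (1 - ?d) / (h / real m) * h = 1 + real m * (?d - 1)"
        using h m by (simp add: field_simps)
      also have "\<dots> \<le> (1 + (?d - 1)) ^ m"
        using transition_nonneg[OF tf, of "h / real m" x x] x h
        by (intro Bernoulli_inequality) simp
      also have "\<dots> = ?d ^ m" by simp
      also have "\<dots> \<le> p (real m * (h / real m)) x x"
        using x h by (intro transition_diag_power) auto
      also have "real m * (h / real m) = h" using m by simp
      finally show "1 - (1 - ?d) / (h / real m) * h \<le> p h x x" .
    qed
  qed auto
qed

lemma truncated_summable:
  assumes "x \<in> S" "t \<ge> 0" "\<And>y. y \<in> S \<Longrightarrow> 0 \<le> w y" "\<And>y. y \<in> S \<Longrightarrow> w y \<le> N"
  shows "(\<lambda>y. p t x y * w y) summable_on S"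
proof (rule summable_on_comparison_test[where f = "\<lambda>y. p t x y * N"])
  show "(\<lambda>y. p t x y * N) summable_on S"
    using transition_has_sum[OF tf assms(2,1)] summable_on_def
    by (intro summable_on_cmult_left) blast
qed (use assms transition_nonneg[OF tf] in \<open>auto intro!: mult_left_mono mult_nonneg_nonneg\<close>)

section \<open>Jump processes with finitely many targets and uniformly bounded total rate\<close>

context
  fixes \<Lambda> :: real and J :: "'s \<Rightarrow> 's set"
  assumes rate_nonneg: "\<And>x y. x \<in> S \<Longrightarrow> y \<in> S \<Longrightarrow> 0 \<le> q x y"
    and finite_J: "\<And>x. x \<in> S \<Longrightarrow> finite (J x)"
    and J_subset: "\<And>x. x \<in> S \<Longrightarrow> J x \<subseteq> S - {x}"
    and rate_eq_0: "\<And>x y. x \<in> S \<Longrightarrow> y \<in> S - {x} - J x \<Longrightarrow> q x y = 0"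
    and rate_le: "\<And>x. x \<in> S \<Longrightarrow> (\<Sum>y\<in>J x. q x y) \<le> \<Lambda>"
begin

lemma exit_rate_has_sum:
  assumes "x \<in> S"
  shows "((\<lambda>y. q x y) has_sum (\<Sum>y\<in>J x. q x y)) (S - {x})"
  using has_sum_finite_neutralI[OF finite_J[OF assms] J_subset[OF assms] rate_eq_0[OF assms] refl] by auto

lemma transition_diag_ge_bound:
  assumes "x \<in> S" "h \<ge> 0"
  shows "1 - \<Lambda> * h \<le> p h x x"
  using transition_diag_ge[OF assms(1) exit_rate_has_sum[OF assms(1)] assms(2)]
    mult_right_mono[OF rate_le[OF assms(1)] assms(2)] by linarith

lemma rate_bound_nonneg: "x \<in> S \<Longrightarrow> 0 \<le> \<Lambda>"
  by (rule order_trans[OF sum_nonneg rate_le]) (use rate_nonneg J_subset in blast)+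

text \<open>In \<open>m\<close> steps from \<open>x\<close> to \<open>y\<close>: either the first step goes to \<open>y\<close> and the rest stay there,
  or the first step stays at \<open>x\<close>.\<close>

lemma transition_offdiag_steps:
  assumes x: "x \<in> S" and y: "y \<in> S" and xy: "x \<noteq> y" and h: "h \<ge> 0" and small: "\<Lambda> * h \<le> 1"
  shows "real m * p h x y * (1 - \<Lambda> * (real m * h)) \<le> p (real m * h) x y"
proof (induction m)
  case 0
  then show ?case using transition_0[OF tf x y] xy by simp
next
  case (Suc m)
  define a where "a = \<Lambda> * h"
  define P where "P = p h x y"
  have a: "0 \<le> a" "a \<le> 1" using rate_bound_nonneg[OF x] h small by (auto simp: a_def)
  have P: "0 \<le> P" using transition_nonneg[OF tf] x y h by (simp add: P_def)
  have mh: "0 \<le> real m * h" using h by simp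
  have IH: "real m * P * (1 - real m * a) \<le> p (real m * h) x y"
    using Suc by (simp add: P_def a_def mult_ac)
  have "(1 - a) * (real m * P * (1 - real m * a)) \<le> p h x x * p (real m * h) x y"
  proof -
    have "(1 - a) * (real m * P * (1 - real m * a)) \<le> (1 - a) * p (real m * h) x y"
      using IH a by (intro mult_left_mono) auto
    also have "\<dots> \<le> p h x x * p (real m * h) x y"
      using transition_diag_ge_bound[OF x h] transition_nonneg[OF tf mh x y]
      by (intro mult_right_mono) (auto simp: a_def)
    finally show ?thesis .
  qed
  moreover have "P * (1 - real m * a) \<le> p h x y * p (real m * h) y y"
    using transition_diag_ge_bound[OF y mh] P
    by (auto simp: P_def a_def mult_ac intro!: mult_left_mono)
  moreover have "p h x x * p (real m * h) x y + p h x y * p (real m * h) y y \<le> p (h + real m * h) x y"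
    using chapman_kolmogorov_finite[of h "real m * h" x y "{x, y}"] x y xy h by simp
  \<comment> \<open>The loss factor for \<open>Suc m\<close> steps is affordable because the surplus
    \<open>P * (a + (real m * a)\<^sup>2)\<close> is nonnegative and can be discarded.\<close>
  moreover have "(1 - a) * (real m * P * (1 - real m * a)) + P * (1 - real m * a)
      = real (Suc m) * P * (1 - a * real (Suc m)) + P * (a + (real m * a)\<^sup>2)"
    by (simp add: algebra_simps power2_eq_square)
  moreover have "0 \<le> P * (a + (real m * a)\<^sup>2)" using P a by simp
  ultimately have "real (Suc m) * P * (1 - a * real (Suc m)) \<le> p (h + real m * h) x y"
    by linarith
  then show ?case by (simp add: P_def a_def algebra_simps)
qed

text \<open>Apply the grid bound with mesh \<open>h / m\<close>, where
  \<open>real m * p (h / real m) x y\<close> tends to \<open>h * q x y\<close>. The relative error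
  \<open>\<Lambda> * h\<close> depends on neither state, a uniformity that the pointwise limit in
  \<open>transition_rate\<close> does not give.\<close>

lemma transition_offdiag_ge:
  assumes x: "x \<in> S" and y: "y \<in> S" and xy: "x \<noteq> y" and h: "h \<ge> 0"
  shows "h * q x y * (1 - \<Lambda> * h) \<le> p h x y"
proof (cases "h = 0")
  case True
  then show ?thesis using transition_0[OF tf x y] xy by simp
next
  case False
  with h have h: "h > 0" by simp
  have "((\<lambda>m. h * (p (h / real m) x y / (h / real m)) * (1 - \<Lambda> * h))
      \<longlongrightarrow> h * q x y * (1 - \<Lambda> * h)) sequentially"
    by (intro tendsto_intros filterlim_compose[OF transition_rate[OF tf x y xy]
        filterlim_divide_of_nat_at_right_0] h)
  then show ?thesis
  proof (rule tendsto_upperbound)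
    \<comment> \<open>Only the mesh has to be small: \<open>\<Lambda> * (h / m) \<le> 1\<close>
      holds from some \<open>m\<close> on, so \<open>h\<close> itself is unrestricted.\<close>
    have "\<forall>\<^sub>F m in sequentially. \<Lambda> * h \<le> real m"
      using filterlim_real_sequentially by (simp add: filterlim_at_top)
    then show "\<forall>\<^sub>F m in sequentially.
        h * (p (h / real m) x y / (h / real m)) * (1 - \<Lambda> * h) \<le> p h x y"
      using eventually_gt_at_top[of 0]
    proof eventually_elim
      fix m :: nat assume m: "\<Lambda> * h \<le> real m" "0 < m"
      then show "h * (p (h / real m) x y / (h / real m)) * (1 - \<Lambda> * h) \<le> p h x y"
        using transition_offdiag_steps[OF x y xy, of "h / real m" m] h by (simp add: field_simps)
    qed
  qed auto
qed

text \<open>Decompose at the first time step and keep only the intermediate states \<open>x\<close>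
  and \<open>J x\<close>; the rest contributes nonnegatively. The factor
  \<open>1 - \<Lambda> * h\<close> in the off-diagonal bound costs
  \<open>\<Lambda> * h\<^sup>2\<close> times a rate sum of at most \<open>\<Lambda> * N\<close>,
  which is the error term.\<close>

lemma truncated_semigroup_step:
  fixes w :: "'s \<Rightarrow> real"
  assumes w: "\<And>y. y \<in> S \<Longrightarrow> 0 \<le> w y" "\<And>y. y \<in> S \<Longrightarrow> w y \<le> N"
    and h: "h \<ge> 0" "\<Lambda> * h \<le> 1" and s: "s \<ge> 0" and x: "x \<in> S"
  defines "u \<equiv> \<lambda>t x. infsum (\<lambda>y. p t x y * w y) S"
  shows "(1 - (\<Sum>y\<in>J x. q x y) * h) * u s x + h * (\<Sum>y\<in>J x. q x y * u s y) - (\<Lambda> * h)\<^sup>2 * N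
      \<le> u (h + s) x"
proof -
  let ?a = "\<Sum>y\<in>J x. q x y"
  note J = finite_J[OF x] J_subset[OF x]
  note summ = truncated_summable[where w = w and N = N, OF _ _ w]
  have u_nonneg: "0 \<le> u s z" if "z \<in> S" for z
    unfolding u_def using that s w transition_nonneg[OF tf] by (intro infsum_nonneg) auto
  have u_le: "u s z \<le> N" if z: "z \<in> S" for z
  proof -
    have "((\<lambda>y. p s z y * w y) has_sum u s z) S"
      unfolding u_def using summ[OF z s] by simp
    moreover have "((\<lambda>y. p s z y * N) has_sum 1 * N) S"
      by (intro has_sum_cmult_left transition_has_sum[OF tf] s z)
    ultimately have "u s z \<le> 1 * N"
      by (rule has_sum_mono) (use w transition_nonneg[OF tf s z] in \<open>simp add: mult_left_mono\<close>)
    then show ?thesis by simp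
  qed
  have N: "0 \<le> N" using w[OF x] by linarith
  have "((\<lambda>y. \<Sum>z\<in>insert x (J x). p h x z * (p s z y * w y)) has_sum
      (\<Sum>z\<in>insert x (J x). p h x z * u s z)) S"
    unfolding u_def using J x s
    by (intro has_sum_finite_sum has_sum_cmult_right has_sum_infsum summ) auto
  moreover have "((\<lambda>y. p (h + s) x y * w y) has_sum u (h + s) x) S"
    unfolding u_def using summ[OF x, of "h + s"] h s by simp
  ultimately have "(\<Sum>z\<in>insert x (J x). p h x z * u s z) \<le> u (h + s) x"
  proof (rule has_sum_mono)
    fix y assume y: "y \<in> S"
    have "(\<Sum>z\<in>insert x (J x). p h x z * (p s z y * w y))
        = (\<Sum>z\<in>insert x (J x). p h x z * p s z y) * w y"
      unfolding sum_distrib_right by (simp add: mult_ac)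
    also have "\<dots> \<le> p (h + s) x y * w y"
      using J x y h s w by (intro mult_right_mono chapman_kolmogorov_finite) auto
    finally show "(\<Sum>z\<in>insert x (J x). p h x z * (p s z y * w y)) \<le> p (h + s) x y * w y" .
  qed
  moreover have "(\<Sum>z\<in>insert x (J x). p h x z * u s z) = p h x x * u s x + (\<Sum>z\<in>J x. p h x z * u s z)"
    using J by (subst sum.insert) auto
  moreover have "(1 - ?a * h) * u s x \<le> p h x x * u s x"
    using transition_diag_ge[OF x exit_rate_has_sum[OF x] h(1)] u_nonneg[OF x] by (rule mult_right_mono)
  moreover have "(\<Sum>z\<in>J x. h * q x z * (1 - \<Lambda> * h) * u s z) \<le> (\<Sum>z\<in>J x. p h x z * u s z)"
    using J x h u_nonneg by (intro sum_mono mult_right_mono transition_offdiag_ge) auto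
  moreover have "(\<Sum>z\<in>J x. h * q x z * (1 - \<Lambda> * h) * u s z)
      = h * (\<Sum>y\<in>J x. q x y * u s y) - \<Lambda> * h\<^sup>2 * (\<Sum>y\<in>J x. q x y * u s y)"
    by (simp add: sum_distrib_left algebra_simps power2_eq_square flip: sum_subtractf)
  moreover have "\<Lambda> * h\<^sup>2 * (\<Sum>y\<in>J x. q x y * u s y) \<le> \<Lambda> * h\<^sup>2 * (\<Lambda> * N)"
  proof -
    have "(\<Sum>y\<in>J x. q x y * u s y) \<le> (\<Sum>y\<in>J x. q x y * N)"
      using J x u_le rate_nonneg by (intro sum_mono mult_left_mono) auto
    also have "\<dots> \<le> \<Lambda> * N"
      unfolding sum_distrib_right[symmetric] using rate_le[OF x] N by (rule mult_right_mono)
    finally show ?thesis using rate_bound_nonneg[OF x] by (intro mult_left_mono) auto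
  qed
  moreover have "\<Lambda> * h\<^sup>2 * (\<Lambda> * N) = (\<Lambda> * h)\<^sup>2 * N" by (simp add: power2_eq_square)
  ultimately show ?thesis by linarith
qed

section \<open>Drift inequality iterated along a time grid\<close>

context
  fixes f :: "'s \<Rightarrow> real" and c K :: real
  assumes f_nonneg: "\<And>x. x \<in> S \<Longrightarrow> 0 \<le> f x"
    and c_pos: "c > 0" and K_nonneg: "K \<ge> 0"
    and drift: "\<And>x. x \<in> S \<Longrightarrow> (\<Sum>y\<in>J x. q x y * (f y - f x)) \<le> K - c * f x"
begin

text \<open>Up to the error, one step replaces \<open>f\<close> in the lower bound by
  \<open>(1 - c * h) * f + h * K\<close>. The coefficients shown are those of the
  \<open>m\<close>-th iterate of this affine map. The lower bound may be negative and involves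
  \<open>f\<close> only at finitely many points per step, so no integrability of \<open>f\<close>
  enters.\<close>

lemma truncated_semigroup_ge:
  fixes w :: "'s \<Rightarrow> real"
  assumes w: "\<And>y. y \<in> S \<Longrightarrow> 0 \<le> w y" "\<And>y. y \<in> S \<Longrightarrow> w y \<le> N" "\<And>y. y \<in> S \<Longrightarrow> N - f y \<le> w y"
    and h: "h \<ge> 0" "\<Lambda> * h \<le> 1" "c * h \<le> 1" and x: "x \<in> S"
  shows "N - (1 - c * h) ^ m * f x - (1 - (1 - c * h) ^ m) * (K / c) - real m * ((\<Lambda> * h)\<^sup>2 * N)
      \<le> infsum (\<lambda>y. p (real m * h) x y * w y) S"
  using x
proof (induction m arbitrary: x)
  case 0
  have "((\<lambda>y. p 0 x y * w y) has_sum w x) S"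
    using 0 transition_0[OF tf 0]
    by (intro has_sum_finite_neutralI[of "{x}"]) auto
  then show ?case using w(3)[OF 0] by (simp add: infsumI)
next
  case (Suc m)
  note x = \<open>x \<in> S\<close>
  let ?u = "\<lambda>t x. infsum (\<lambda>y. p t x y * w y) S"
  let ?a = "\<Sum>y\<in>J x. q x y"
  define r where "r = (1 - c * h) ^ m"
  define B where "B = N - (1 - r) * (K / c) - real m * ((\<Lambda> * h)\<^sup>2 * N)"
  have r: "0 \<le> r" using h by (simp add: r_def)
  have IH: "B - r * f z \<le> ?u (real m * h) z" if "z \<in> S" for z
    using Suc.IH[OF that] by (simp add: B_def r_def)
  \<comment> \<open>A nonnegative diagonal coefficient is what allows the induction hypothesis to be
    inserted at \<open>x\<close> itself.\<close>
  have ah: "?a * h \<le> 1" using mult_right_mono[OF rate_le[OF x] h(1)] h by linarith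
  have "B - r * ((1 - c * h) * f x + h * K) \<le> B - r * (f x + h * (\<Sum>y\<in>J x. q x y * (f y - f x)))"
  proof -
    have "h * (\<Sum>y\<in>J x. q x y * (f y - f x)) \<le> h * (K - c * f x)"
      using drift[OF x] h by (intro mult_left_mono) auto
    then have "f x + h * (\<Sum>y\<in>J x. q x y * (f y - f x)) \<le> (1 - c * h) * f x + h * K"
      by (simp add: algebra_simps)
    then show ?thesis using r by (simp add: mult_left_mono)
  qed
  \<comment> \<open>\<open>I + h Q\<close> fixes constants, so \<open>B\<close> passes through
    unchanged and only \<open>f\<close> feels the generator.\<close>
  also have "\<dots> = (1 - ?a * h) * (B - r * f x) + h * (\<Sum>y\<in>J x. q x y * (B - r * f y))"
    by (simp add: algebra_simps sum_distrib_left sum_distrib_right sum_subtractf)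
  also have "\<dots> \<le> (1 - ?a * h) * ?u (real m * h) x + h * (\<Sum>y\<in>J x. q x y * ?u (real m * h) y)"
    using IH x ah h J_subset[OF x] rate_nonneg[OF x]
    by (intro add_mono mult_left_mono sum_mono) auto
  finally have "B - r * ((1 - c * h) * f x + h * K) - (\<Lambda> * h)\<^sup>2 * N
      \<le> (1 - ?a * h) * ?u (real m * h) x + h * (\<Sum>y\<in>J x. q x y * ?u (real m * h) y) - (\<Lambda> * h)\<^sup>2 * N"
    by simp
  also have "\<dots> \<le> ?u (h + real m * h) x"
    using h x by (intro truncated_semigroup_step w) auto
  finally have "B - r * ((1 - c * h) * f x + h * K) - (\<Lambda> * h)\<^sup>2 * N \<le> ?u (real (Suc m) * h) x"
    by (simp add: algebra_simps)
  moreover have "B - r * ((1 - c * h) * f x + h * K) - (\<Lambda> * h)\<^sup>2 * N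
      = N - (1 - c * h) ^ Suc m * f x - (1 - (1 - c * h) ^ Suc m) * (K / c)
        - real (Suc m) * ((\<Lambda> * h)\<^sup>2 * N)"
    using c_pos by (simp add: B_def r_def field_simps)
  ultimately show ?case by simp
qed

text \<open>With mesh \<open>t / m\<close> there are \<open>m\<close> errors of order
  \<open>1 / m\<^sup>2\<close>, so for fixed \<open>N\<close> their sum vanishes. The decay of the
  initial value is given away: a bound free of \<open>t\<close> is all that is wanted.\<close>

lemma truncated_semigroup_bound:
  fixes w :: "'s \<Rightarrow> real"
  assumes w: "\<And>y. y \<in> S \<Longrightarrow> 0 \<le> w y" "\<And>y. y \<in> S \<Longrightarrow> w y \<le> N" "\<And>y. y \<in> S \<Longrightarrow> N - f y \<le> w y"
    and t: "t \<ge> 0" and x: "x \<in> S"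
  shows "N - f x - K / c \<le> infsum (\<lambda>y. p t x y * w y) S"
proof -
  have "((\<lambda>m. N - f x - K / c - (\<Lambda> * t)\<^sup>2 * N / real m) \<longlongrightarrow> N - f x - K / c - 0) sequentially"
    by (intro tendsto_intros real_tendsto_divide_at_top[OF tendsto_const] filterlim_real_sequentially)
  then have "N - f x - K / c - 0 \<le> infsum (\<lambda>y. p t x y * w y) S"
  proof (rule tendsto_upperbound)
    have "\<forall>\<^sub>F m in sequentially. \<Lambda> * t \<le> real m" "\<forall>\<^sub>F m in sequentially. c * t \<le> real m"
      using filterlim_real_sequentially by (auto simp: filterlim_at_top)
    then show "\<forall>\<^sub>F m in sequentially. N - f x - K / c - (\<Lambda> * t)\<^sup>2 * N / real m
        \<le> infsum (\<lambda>y. p t x y * w y) S"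
      using eventually_gt_at_top[of 0]
    proof eventually_elim
      fix m :: nat assume m: "\<Lambda> * t \<le> real m" "c * t \<le> real m" "0 < m"
      define h where "h = t / real m"
      define r where "r = (1 - c * h) ^ m"
      have h: "h \<ge> 0" "\<Lambda> * h \<le> 1" "c * h \<le> 1" and mh: "real m * h = t"
        using m t by (auto simp: h_def field_simps)
      have r: "0 \<le> r" "r \<le> 1" using h c_pos by (auto simp: r_def intro!: power_le_one)
      have "r * f x \<le> 1 * f x" using r f_nonneg[OF x] by (intro mult_right_mono) auto
      moreover have "(1 - r) * (K / c) \<le> 1 * (K / c)"
        using r c_pos K_nonneg by (intro mult_right_mono) auto
      moreover have "real m * ((\<Lambda> * h)\<^sup>2 * N) = (\<Lambda> * t)\<^sup>2 * N / real m"
        using m by (simp add: h_def power2_eq_square field_simps)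
      ultimately show "N - f x - K / c - (\<Lambda> * t)\<^sup>2 * N / real m \<le> infsum (\<lambda>y. p t x y * w y) S"
        using truncated_semigroup_ge[where w = w and N = N and h = h and m = m and x = x, OF w h x]
        unfolding mh r_def[symmetric] by linarith
    qed
  qed auto
  then show ?thesis by simp
qed

end

end

end


section \<open>From the transition function to expectations of the process\<close>

lemma nn_integral_le_of_truncations:
  fixes g :: "'a \<Rightarrow> real"
  assumes [measurable]: "g \<in> borel_measurable M"
    and bound: "\<And>N. (\<integral>\<^sup>+ \<omega>. ennreal (min (g \<omega>) (real N)) \<partial>M) \<le> C"
  shows "(\<integral>\<^sup>+ \<omega>. ennreal (g \<omega>) \<partial>M) \<le> C"
proof -
  have "(\<integral>\<^sup>+ \<omega>. ennreal (g \<omega>) \<partial>M) \<le> (\<integral>\<^sup>+ \<omega>. (SUP N. ennreal (min (g \<omega>) (real N))) \<partial>M)"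
  proof (rule nn_integral_mono)
    fix \<omega>
    obtain N where N: "g \<omega> \<le> real N" using real_arch_simple by blast
    then have "ennreal (g \<omega>) = ennreal (min (g \<omega>) (real N))" by (simp add: min_absorb1)
    also have "\<dots> \<le> (SUP N. ennreal (min (g \<omega>) (real N)))" by (rule SUP_upper) simp
    finally show "ennreal (g \<omega>) \<le> (SUP N. ennreal (min (g \<omega>) (real N)))" .
  qed
  also have "\<dots> = (SUP N. \<integral>\<^sup>+ \<omega>. ennreal (min (g \<omega>) (real N)) \<partial>M)"
    by (rule nn_integral_monotone_convergence_SUP)
      (auto simp: incseq_def le_fun_def intro!: ennreal_leI min.mono)
  also have "\<dots> \<le> C" by (rule SUP_least) (rule bound)
  finally show ?thesis .
qed

text \<open>The Markov property at time 0 on the event \<open>space M\<close>; the deterministic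
  start makes \<open>X 0 = x\<close> an event of probability one.\<close>

lemma markov_jump_process_distribution:
  assumes X0: "AE \<omega> in M. X 0 \<omega> = x" and M: "prob_space M"
    and X: "\<And>t. t \<ge> 0 \<Longrightarrow> X t \<in> measurable M (count_space S)"
    and markov: "\<And>A t x y. A \<in> past_events M S X 0 \<Longrightarrow> t \<ge> 0 \<Longrightarrow> x \<in> S \<Longrightarrow> y \<in> S \<Longrightarrow>
           measure M {\<omega> \<in> A. X 0 \<omega> = x \<and> X (0 + t) \<omega> = y} = measure M {\<omega> \<in> A. X 0 \<omega> = x} * p t x y"
    and t: "t \<ge> 0" and x: "x \<in> S" and y: "y \<in> S"
  shows "measure M (X t -` {y} \<inter> space M) = p t x y"
proof -
  interpret prob_space M by (rule M)
  have sets: "X s -` {z} \<inter> space M \<in> sets M" if "s \<ge> 0" "z \<in> S" for s z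
    using measurable_sets[OF X[OF that(1)]] that(2) by simp
  have "space M \<in> past_events M S X 0"
    unfolding past_events_def by (rule sigma_sets_top)
  from markov[OF this t x y]
  have "measure M {\<omega> \<in> space M. X 0 \<omega> = x \<and> X t \<omega> = y}
      = measure M {\<omega> \<in> space M. X 0 \<omega> = x} * p t x y" by simp
  moreover have "measure M {\<omega> \<in> space M. X 0 \<omega> = x} = 1"
    using sets[OF _ x, of 0] X0 by (intro prob_eq_1[THEN iffD2]) (auto simp: vimage_def Int_def conj_commute)
  moreover have "measure M {\<omega> \<in> space M. X 0 \<omega> = x \<and> X t \<omega> = y} = measure M (X t -` {y} \<inter> space M)"
  proof (rule finite_measure_eq_AE)
    have "{\<omega> \<in> space M. X 0 \<omega> = x \<and> X t \<omega> = y}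
        = (X 0 -` {x} \<inter> space M) \<inter> (X t -` {y} \<inter> space M)" by auto
    then show "{\<omega> \<in> space M. X 0 \<omega> = x \<and> X t \<omega> = y} \<in> sets M"
      using sets x y t by simp
    show "X t -` {y} \<inter> space M \<in> sets M" using sets y t by simp
    show "AE \<omega> in M. (\<omega> \<in> {\<omega> \<in> space M. X 0 \<omega> = x \<and> X t \<omega> = y}) = (\<omega> \<in> X t -` {y} \<inter> space M)"
      using X0 by eventually_elim auto
  qed
  ultimately show ?thesis by simp
qed

theorem markov_jump_process_lyapunov_bound:
  fixes f :: "'s \<Rightarrow> real" and J :: "'s \<Rightarrow> 's set"
  assumes mjp: "markov_jump_process M S q x0 X" and x0: "x0 \<in> S"
    and rate_nonneg: "\<And>x y. x \<in> S \<Longrightarrow> y \<in> S \<Longrightarrow> 0 \<le> q x y"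
    and finite_J: "\<And>x. x \<in> S \<Longrightarrow> finite (J x)"
    and J_subset: "\<And>x. x \<in> S \<Longrightarrow> J x \<subseteq> S - {x}"
    and rate_eq_0: "\<And>x y. x \<in> S \<Longrightarrow> y \<in> S - {x} - J x \<Longrightarrow> q x y = 0"
    and rate_le: "\<And>x. x \<in> S \<Longrightarrow> (\<Sum>y\<in>J x. q x y) \<le> \<Lambda>"
    and f_nonneg: "\<And>x. x \<in> S \<Longrightarrow> 0 \<le> f x"
    and c: "c > 0" and K: "K \<ge> 0"
    and drift: "\<And>x. x \<in> S \<Longrightarrow> (\<Sum>y\<in>J x. q x y * (f y - f x)) \<le> K - c * f x"
    and t: "t \<ge> 0"
  shows "(\<integral>\<^sup>+ \<omega>. ennreal (f (X t \<omega>)) \<partial>M) \<le> ennreal (f x0 + K / c)"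
proof -
  interpret prob_space M using mjp by (simp add: markov_jump_process_def)
  have Xm: "X t \<in> measurable M (count_space S)" if "t \<ge> 0" for t
    using mjp that by (simp add: markov_jump_process_def)
  note [measurable] = Xm[OF t]
  obtain p where tf: "transition_function S q p"
    and markov: "\<forall>s\<ge>0. \<forall>t\<ge>0. \<forall>A\<in>past_events M S X s. \<forall>x\<in>S. \<forall>y\<in>S.
           measure M {\<omega> \<in> A. X s \<omega> = x \<and> X (s + t) \<omega> = y}
             = measure M {\<omega> \<in> A. X s \<omega> = x} * p t x y"
    using mjp unfolding markov_jump_process_def by (elim conjE exE) (rule that)
  have X0: "AE \<omega> in M. X 0 \<omega> = x0" using mjp by (simp add: markov_jump_process_def)
  have markov0: "measure M {\<omega> \<in> A. X 0 \<omega> = x \<and> X (0 + t) \<omega> = y}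
      = measure M {\<omega> \<in> A. X 0 \<omega> = x} * p t x y"
    if "A \<in> past_events M S X 0" "t \<ge> 0" "x \<in> S" "y \<in> S" for A t x y
    using markov[rule_format, of 0 t A x y] that by simp
  have distr: "measure M (X t -` {y} \<inter> space M) = p t x0 y" if "y \<in> S" for y
    by (rule markov_jump_process_distribution[OF X0 prob_space_axioms _ markov0 t x0 that])
      (auto intro: Xm)
  have XS: "X t \<omega> \<in> S" if "\<omega> \<in> space M" for \<omega>
    using measurable_space[OF Xm[OF t] that] by simp
  have comp: "(\<lambda>\<omega>. g (X t \<omega>)) \<in> borel_measurable M" for g :: "'s \<Rightarrow> real"
    by (rule measurable_compose[OF Xm[OF t]]) simp
  show ?thesis
  proof (rule nn_integral_le_of_truncations)
    fix N :: nat
    \<comment> \<open>\<open>N - w\<close> equals \<open>min f N\<close>, so a lower bound on the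
      mean of \<open>w\<close> is an upper bound on the truncated mean of \<open>f\<close>.\<close>
    define w where "w y = max 0 (real N - f y)" for y
    have w: "0 \<le> w y" "y \<in> S \<Longrightarrow> w y \<le> real N" "real N - f y \<le> w y" for y
      using f_nonneg by (auto simp: w_def)
    have int_w: "integrable M (\<lambda>\<omega>. w (X t \<omega>))"
      using w XS by (intro integrable_const_bound[where B = "real N"] comp) auto
    have summ: "(\<lambda>y. p t x0 y * w y) summable_on S"
      by (rule truncated_summable[where N = "real N", OF tf x0 t]) (use w in auto)
    have "real N - f x0 - K / c \<le> infsum (\<lambda>y. p t x0 y * w y) S"
      by (rule truncated_semigroup_bound[OF tf rate_nonneg finite_J J_subset rate_eq_0 rate_le f_nonneg c K drift _ _ _ t x0])
        (use w in auto)
    also have "\<dots> \<le> expectation (\<lambda>\<omega>. w (X t \<omega>))"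
    proof (rule infsum_le_finite_sums[OF summ])
      \<comment> \<open>A finite partial sum is the mean of \<open>w (X t)\<close> on the event that
        \<open>X t\<close> lies in \<open>F\<close>. Only an inequality is needed, so no infinite
        sum is exchanged with the integral.\<close>
      fix F assume F: "finite F" "F \<subseteq> S"
      have int: "integrable M (\<lambda>\<omega>. indicat_real (X t -` {y} \<inter> space M) \<omega> * w y)" if "y \<in> F" for y
        using measurable_sets[OF Xm[OF t], of "{y}"] that F(2)
        by (intro integrable_mult_left integrable_real_indicator) (auto simp: emeasure_eq_measure)
      have "(\<Sum>y\<in>F. p t x0 y * w y)
          = (\<Sum>y\<in>F. expectation (\<lambda>\<omega>. indicat_real (X t -` {y} \<inter> space M) \<omega> * w y))"
        using F(2) distr by (intro sum.cong) auto
      also have "\<dots> = expectation (\<lambda>\<omega>. \<Sum>y\<in>F. indicat_real (X t -` {y} \<inter> space M) \<omega> * w y)"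
        using int by (intro Bochner_Integration.integral_sum[symmetric])
      also have "\<dots> \<le> expectation (\<lambda>\<omega>. w (X t \<omega>))"
      proof (rule integral_mono)
        fix \<omega> assume "\<omega> \<in> space M"
        then have "(\<Sum>y\<in>F. indicat_real (X t -` {y} \<inter> space M) \<omega> * w y)
            = (\<Sum>y\<in>F. if y = X t \<omega> then w y else 0)"
          by (intro sum.cong) (auto simp: indicator_def)
        also have "\<dots> \<le> w (X t \<omega>)" using F w by simp
        finally show "(\<Sum>y\<in>F. indicat_real (X t -` {y} \<inter> space M) \<omega> * w y) \<le> w (X t \<omega>)" .
      qed (use int int_w in auto)
      finally show "(\<Sum>y\<in>F. p t x0 y * w y) \<le> expectation (\<lambda>\<omega>. w (X t \<omega>))" .
    qed
    finally have lower: "real N - f x0 - K / c \<le> expectation (\<lambda>\<omega>. w (X t \<omega>))" .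
    have "(\<integral>\<^sup>+ \<omega>. ennreal (min (f (X t \<omega>)) (real N)) \<partial>M)
        = (\<integral>\<^sup>+ \<omega>. ennreal (real N - w (X t \<omega>)) \<partial>M)"
      by (intro nn_integral_cong arg_cong[where f = ennreal]) (auto simp: w_def)
    also have "\<dots> = ennreal (expectation (\<lambda>\<omega>. real N - w (X t \<omega>)))"
      using w XS int_w by (intro nn_integral_eq_integral) auto
    also have "expectation (\<lambda>\<omega>. real N - w (X t \<omega>)) = real N - expectation (\<lambda>\<omega>. w (X t \<omega>))"
      using int_w by (simp add: prob_space)
    also have "ennreal \<dots> \<le> ennreal (f x0 + K / c)"
      using lower by (intro ennreal_leI) linarith
    finally show "(\<integral>\<^sup>+ \<omega>. ennreal (min (f (X t \<omega>)) (real N)) \<partial>M) \<le> ennreal (f x0 + K / c)" .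
  qed (rule comp)
qed

section \<open>Gaps between the walkers\<close>

text \<open>A downward closed predicate holds exactly on an initial segment of a sorted list. This
  converts counts such as \<open>walkers_left_of\<close> into statements about ranks.\<close>

lemma sorted_nth_iff_filter:
  assumes "sorted xs" "j < length xs" and down: "\<And>x y. x \<le> y \<Longrightarrow> P y \<Longrightarrow> P x"
  shows "P (xs ! j) \<longleftrightarrow> j < length (filter P xs)"
  using assms(1,2)
proof (induction xs arbitrary: j)
  case (Cons x xs)
  show ?case
  proof (cases "P x")
    case True
    show ?thesis
    proof (cases j)
      case (Suc i)
      then show ?thesis using Cons.IH[of i] Cons.prems True by simp
    qed (use True in simp)
  next
    case False
    then have "\<not> P y" if "y \<in> set (x # xs)" for y
      using down[of x y] Cons.prems(1) that by auto
    moreover from this have "filter P (x # xs) = []" unfolding filter_empty_conv by blast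
    ultimately show ?thesis using nth_mem[OF Cons.prems(2)] by simp
  qed
qed simp

lemma half_integers_less:
  assumes "x \<in> half_integers" "y \<in> half_integers" "x < y"
  shows "x + 1 \<le> y"
proof -
  obtain a b :: int where "x = of_int a + 1 / 2" "y = of_int b + 1 / 2"
    using assms(1,2) by (auto simp: half_integers_def)
  moreover from this assms(3) have "a + 1 \<le> b" by simp
  then have "of_int a + 1 \<le> (of_int b :: real)" by linarith
  ultimately show ?thesis by simp
qed

lemma half_integers_add_of_int:
  assumes "x \<in> half_integers"
  shows "x + of_int k \<in> half_integers"
proof -
  obtain a :: int where "x = of_int a + 1 / 2"
    using assms by (auto simp: half_integers_def)
  then have "x + of_int k = of_int (a + k) + 1 / 2" by simp
  then show ?thesis unfolding half_integers_def by blast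
qed

lemma half_integers_add_1: "x \<in> half_integers \<Longrightarrow> x + 1 \<in> half_integers"
  using half_integers_add_of_int[of x 1] by simp

lemma half_integers_diff_1: "x \<in> half_integers \<Longrightarrow> x - 1 \<in> half_integers"
  using half_integers_add_of_int[of x "-1"] by simp

text \<open>The order statistics, counted from 0 at the left. They restore labels that the multiset
  forgets; walkers sharing a site hold a block of consecutive ranks.\<close>

definition position :: "real multiset \<Rightarrow> nat \<Rightarrow> real" where
  "position c r = sorted_list_of_multiset c ! r"

definition gap :: "real multiset \<Rightarrow> nat \<Rightarrow> real" where
  "gap c r = position c (Suc r) - position c r"

lemma length_sorted_list_of_multiset: "length (sorted_list_of_multiset c) = size c"
  by (metis mset_sorted_list_of_multiset size_mset)

lemma position_mono: "r \<le> s \<Longrightarrow> s < size c \<Longrightarrow> position c r \<le> position c s"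
  by (simp add: position_def sorted_nth_mono length_sorted_list_of_multiset)

lemma position_in: "r < size c \<Longrightarrow> position c r \<in># c"
  by (metis length_sorted_list_of_multiset nth_mem position_def set_sorted_list_of_multiset)

lemma position_less_iff:
  assumes "j < size c"
  shows "position c j < i \<longleftrightarrow> j < walkers_left_of c i"
proof -
  have "walkers_left_of c i = size (filter_mset (\<lambda>j. j < i) (mset (sorted_list_of_multiset c)))"
    by (simp add: walkers_left_of_def)
  also have "\<dots> = length (filter (\<lambda>j. j < i) (sorted_list_of_multiset c))"
    by (simp only: mset_filter[symmetric] size_mset)
  finally show ?thesis
    using sorted_nth_iff_filter[of "sorted_list_of_multiset c" j "\<lambda>j. j < i"] assms
    by (simp add: position_def length_sorted_list_of_multiset)
qed

lemma walkers_left_of_add_count: "walkers_left_of c i + count c i = size (filter_mset (\<lambda>j. j \<le> i) c)"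
  unfolding walkers_left_of_def by (induction c) auto

lemma position_le_iff:
  assumes "j < size c"
  shows "position c j \<le> i \<longleftrightarrow> j < walkers_left_of c i + count c i"
proof -
  have "walkers_left_of c i + count c i
      = size (filter_mset (\<lambda>j. j \<le> i) (mset (sorted_list_of_multiset c)))"
    by (simp add: walkers_left_of_add_count)
  also have "\<dots> = length (filter (\<lambda>j. j \<le> i) (sorted_list_of_multiset c))"
    by (simp only: mset_filter[symmetric] size_mset)
  finally show ?thesis
    using sorted_nth_iff_filter[of "sorted_list_of_multiset c" j "\<lambda>j. j \<le> i"] assms
    by (simp add: position_def length_sorted_list_of_multiset)
qed

lemma position_eq_iff:
  assumes "j < size c"
  shows "position c j = i \<longleftrightarrow> walkers_left_of c i \<le> j \<and> j < walkers_left_of c i + count c i"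
  using position_less_iff[OF assms, of i] position_le_iff[OF assms, of i] by auto

lemma walkers_left_of_add_count_le: "walkers_left_of c i + count c i \<le> size c"
  unfolding walkers_left_of_add_count by (rule size_mset_mono) simp

section \<open>Effect of a jump on ordered positions and gaps\<close>

lemma move_walker_in_configurations:
  assumes "c \<in> configurations n" "i \<in># c" "j \<in> half_integers"
  shows "move_walker c i j \<in> configurations n"
proof -
  have "size (move_walker c i j) = size c"
    using assms(2) by (metis add_mset_add_single insert_DiffM move_walker_def size_add_mset)
  moreover have "set_mset (move_walker c i j) \<subseteq> insert j (set_mset c)"
    unfolding move_walker_def by (auto dest: in_diffD)
  ultimately show ?thesis using assms by (auto simp: configurations_def)
qed

lemma move_walker_neq: "i \<noteq> j \<Longrightarrow> move_walker c i j \<noteq> c"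
proof
  assume "i \<noteq> j" "move_walker c i j = c"
  moreover have "count (move_walker c i j) j = Suc (count c j)"
    using \<open>i \<noteq> j\<close> by (simp add: move_walker_def)
  ultimately show False by simp
qed

text \<open>Moving one walker without overtaking keeps the list sorted, and a sorted list is
  determined by its multiset.\<close>

lemma sorted_list_of_move_walker:
  assumes s: "s < size c" and i: "position c s = i"
    and below: "\<And>r. r < s \<Longrightarrow> position c r \<le> j"
    and above: "\<And>r. s < r \<Longrightarrow> r < size c \<Longrightarrow> j \<le> position c r"
  shows "sorted_list_of_multiset (move_walker c i j) = (sorted_list_of_multiset c)[s := j]"
proof -
  let ?xs = "sorted_list_of_multiset c"
  have len: "length ?xs = size c" by (rule length_sorted_list_of_multiset)
  have "mset (?xs[s := j]) = move_walker c i j"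
    using s i by (simp add: mset_update len position_def move_walker_def)
  moreover have "sorted (?xs[s := j])"
    unfolding sorted_iff_nth_mono
  proof (intro allI impI)
    fix a b assume ab: "a \<le> b" "b < length (?xs[s := j])"
    then have "?xs ! a \<le> ?xs ! b" "a < size c" "b < size c" by (simp_all add: sorted_nth_mono len)
    moreover have "?xs ! a \<le> j" if "a \<noteq> s" "b = s"
      using ab that below[of a] by (simp add: position_def)
    moreover have "j \<le> ?xs ! b" if "b \<noteq> s" "a = s"
      using ab that above[of b] by (simp add: position_def len)
    ultimately show "?xs[s := j] ! a \<le> ?xs[s := j] ! b"
      using s by (simp add: nth_list_update len)
  qed
  ultimately show ?thesis
    by (metis sorted_list_of_multiset_mset sorted_sort_id)
qed

text \<open>Walkers at one site are interchangeable, so the jumper may be taken to be the one of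
  highest rank there. It then overtakes nobody, because half-integers beyond \<open>i\<close> are at
  least \<open>i + 1\<close>.\<close>

lemma position_move_right:
  assumes c: "c \<in> configurations n" and i: "i \<in># c" and r: "r < n"
  shows "position (move_walker c i (i + 1)) r
    = (if Suc r = walkers_left_of c i + count c i then i + 1 else position c r)"
proof -
  define s where "s = walkers_left_of c i + count c i - 1"
  have cnt: "0 < count c i" using i by simp
  have size: "size c = n" using c by (simp add: configurations_def)
  have s: "s < size c" using walkers_left_of_add_count_le[of c i] cnt unfolding s_def by linarith
  have "sorted_list_of_multiset (move_walker c i (i + 1)) = (sorted_list_of_multiset c)[s := i + 1]"
  proof (rule sorted_list_of_move_walker[OF s])
    show eq: "position c s = i"
      using position_eq_iff[OF s, of i] cnt unfolding s_def by linarith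
    show "position c a \<le> i + 1" if "a < s" for a
      using position_mono[of a s c] that s eq by simp
    show "i + 1 \<le> position c a" if "s < a" "a < size c" for a
    proof (rule half_integers_less)
      show "i \<in> half_integers" "position c a \<in> half_integers"
        using c i position_in[OF that(2)] by (auto simp: configurations_def)
      show "i < position c a" using position_le_iff[OF that(2), of i] that(1) unfolding s_def by linarith
    qed
  qed
  then show ?thesis using r size cnt s
    by (auto simp: position_def nth_list_update length_sorted_list_of_multiset s_def)
qed

text \<open>Mirror image: the jumper is now the lowest rank at its site.\<close>

lemma position_move_left:
  assumes c: "c \<in> configurations n" and i: "i \<in># c" and r: "r < n"
  shows "position (move_walker c i (i - 1)) r
    = (if r = walkers_left_of c i then i - 1 else position c r)"
proof -
  define s where "s = walkers_left_of c i"
  have cnt: "0 < count c i" using i by simp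
  have size: "size c = n" using c by (simp add: configurations_def)
  have s: "s < size c" using walkers_left_of_add_count_le[of c i] cnt unfolding s_def by linarith
  have "sorted_list_of_multiset (move_walker c i (i - 1)) = (sorted_list_of_multiset c)[s := i - 1]"
  proof (rule sorted_list_of_move_walker[OF s])
    show eq: "position c s = i"
      using position_eq_iff[OF s, of i] cnt unfolding s_def by linarith
    show "i - 1 \<le> position c a" if "s < a" "a < size c" for a
      using position_mono[of s a c] that s eq by simp
    show "position c a \<le> i - 1" if "a < s" for a
    proof -
      have a: "a < size c" using that s by simp
      have "position c a + 1 \<le> i"
      proof (rule half_integers_less)
        show "i \<in> half_integers" "position c a \<in> half_integers"
          using c i position_in[OF a] by (auto simp: configurations_def)
        show "position c a < i" using position_less_iff[OF a, of i] that by (simp add: s_def)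
      qed
      then show ?thesis by simp
    qed
  qed
  then show ?thesis using r size s
    by (auto simp: position_def nth_list_update length_sorted_list_of_multiset s_def)
qed

lemma gap_nonneg: "c \<in> configurations n \<Longrightarrow> Suc r < n \<Longrightarrow> 0 \<le> gap c r"
  using position_mono[of r "Suc r" c] by (simp add: gap_def configurations_def)

text \<open>The jumper has rank \<open>s - 1\<close>: it is the left end of the gap if
  \<open>s = Suc r\<close> and the right end if \<open>s = Suc (Suc r)\<close>.\<close>

lemma gap_move_right:
  assumes c: "c \<in> configurations n" and i: "i \<in># c" and r: "Suc r < n"
  defines "s \<equiv> walkers_left_of c i + count c i"
  shows "gap (move_walker c i (i + 1)) r
    = gap c r + (if s = Suc (Suc r) then 1 else 0) - (if s = Suc r then 1 else 0)"
proof -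
  have size: "size c = n" using c by (simp add: configurations_def)
  have cnt: "0 < count c i" using i by simp
  have "position c j = i" if j: "Suc j = s" "j < n" for j
  proof -
    have "walkers_left_of c i \<le> j" "j < walkers_left_of c i + count c i"
      using j cnt unfolding s_def by linarith+
    then show ?thesis using position_eq_iff[of j c i] j size by simp
  qed
  then show ?thesis
    using position_move_right[OF c i, of r] position_move_right[OF c i, of "Suc r"] r
    by (auto simp: gap_def s_def)
qed

lemma gap_move_left:
  assumes c: "c \<in> configurations n" and i: "i \<in># c" and r: "Suc r < n"
  defines "k \<equiv> walkers_left_of c i"
  shows "gap (move_walker c i (i - 1)) r
    = gap c r + (if k = r then 1 else 0) - (if k = Suc r then 1 else 0)"
proof -
  have size: "size c = n" using c by (simp add: configurations_def)
  have "position c k = i" if "k < n"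
    using that i size position_eq_iff[of k c i] by (simp add: k_def)
  then show ?thesis
    using position_move_left[OF c i, of r] position_move_left[OF c i, of "Suc r"] r
    by (auto simp: gap_def k_def)
qed

text \<open>In this form the rate telescopes over the ranks \<open>j\<close> held at the site, each
  contributing \<open>exp (\<theta> - j * \<beta>) * (1 - exp (- \<beta>))\<close>. For
  \<open>\<beta> > 0\<close> it is monotone in either end of the block of ranks, which allows
  comparison with a single walker.\<close>

lemma right_rate_eq:
  "right_rate \<beta> \<theta> c i = exp \<theta> * (exp (- real (walkers_left_of c i) * \<beta>)
     - exp (- real (walkers_left_of c i + count c i) * \<beta>))"
proof -
  have "exp (\<theta> - real (walkers_left_of c i) * \<beta>) = exp \<theta> * exp (- real (walkers_left_of c i) * \<beta>)"
    "exp (- real (walkers_left_of c i + count c i) * \<beta>)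
      = exp (- real (walkers_left_of c i) * \<beta>) * exp (- real (count c i) * \<beta>)"
    unfolding exp_add[symmetric] by (simp_all add: algebra_simps)
  then show ?thesis unfolding right_rate_def by (simp only: right_diff_distrib mult.assoc mult_1_right)
qed

lemma left_rate_eq:
  "left_rate \<beta> \<theta> c i = exp (- \<theta>) * (exp (real (walkers_left_of c i + count c i) * \<beta>)
     - exp (real (walkers_left_of c i) * \<beta>))"
proof -
  have "exp (- \<theta> + real (walkers_left_of c i) * \<beta>) = exp (- \<theta>) * exp (real (walkers_left_of c i) * \<beta>)"
    "exp (real (walkers_left_of c i + count c i) * \<beta>)
      = exp (real (walkers_left_of c i) * \<beta>) * exp (real (count c i) * \<beta>)"
    unfolding exp_add[symmetric] by (simp_all add: algebra_simps)
  then show ?thesis unfolding left_rate_def by (simp only: right_diff_distrib mult.assoc mult_1_right)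
qed

lemma right_rate_nonneg: "\<beta> > 0 \<Longrightarrow> 0 \<le> right_rate \<beta> \<theta> c i"
  by (simp add: right_rate_def)

lemma left_rate_nonneg: "\<beta> > 0 \<Longrightarrow> 0 \<le> left_rate \<beta> \<theta> c i"
  by (simp add: left_rate_def)

lemma walker_rate_nonneg: "\<beta> > 0 \<Longrightarrow> 0 \<le> walker_rate \<beta> \<theta> c c'"
  unfolding walker_rate_def
  by (intro sum_nonneg add_nonneg_nonneg) (simp_all add: right_rate_nonneg left_rate_nonneg)

section \<open>Jump targets and the total jump rate\<close>

definition jump_targets :: "real multiset \<Rightarrow> real multiset set" where
  "jump_targets c =
     (\<lambda>i. move_walker c i (i + 1)) ` set_mset c \<union> (\<lambda>i. move_walker c i (i - 1)) ` set_mset c"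

lemma finite_jump_targets: "finite (jump_targets c)"
  by (simp add: jump_targets_def)

lemma jump_targets_subset:
  assumes "c \<in> configurations n"
  shows "jump_targets c \<subseteq> configurations n - {c}"
proof -
  have "i \<in> half_integers" if "i \<in># c" for i
    using assms that by (auto simp: configurations_def)
  then have "move_walker c i (i + 1) \<in> configurations n - {c}"
    "move_walker c i (i - 1) \<in> configurations n - {c}" if i: "i \<in># c" for i
    using move_walker_in_configurations[OF assms i half_integers_add_1]
      move_walker_in_configurations[OF assms i half_integers_diff_1] i
      move_walker_neq[of i "i + 1" c] move_walker_neq[of i "i - 1" c] by simp_all
  then show ?thesis
    unfolding jump_targets_def by (intro Un_least image_subsetI) simp_all
qed

lemma walker_rate_eq_0: "c' \<notin> jump_targets c \<Longrightarrow> walker_rate \<beta> \<theta> c c' = 0"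
  unfolding walker_rate_def jump_targets_def by (intro sum.neutral) auto

text \<open>Exchanging the sums turns the generator into a sum over sites and directions; it need
  not be known that distinct jumps have distinct targets.\<close>

lemma sum_walker_rate:
  "(\<Sum>c'\<in>jump_targets c. walker_rate \<beta> \<theta> c c' * g c')
     = (\<Sum>i\<in>set_mset c. right_rate \<beta> \<theta> c i * g (move_walker c i (i + 1))
          + left_rate \<beta> \<theta> c i * g (move_walker c i (i - 1)))"
proof -
  have "(\<Sum>c'\<in>jump_targets c. walker_rate \<beta> \<theta> c c' * g c')
      = (\<Sum>i\<in>set_mset c. \<Sum>c'\<in>jump_targets c.
          (if c' = move_walker c i (i + 1) then right_rate \<beta> \<theta> c i * g c' else 0) +
          (if c' = move_walker c i (i - 1) then left_rate \<beta> \<theta> c i * g c' else 0))"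
    unfolding walker_rate_def sum_distrib_right
    by (subst sum.swap) (auto intro!: sum.cong simp: distrib_right)
  also have "\<dots> = (\<Sum>i\<in>set_mset c. right_rate \<beta> \<theta> c i * g (move_walker c i (i + 1))
          + left_rate \<beta> \<theta> c i * g (move_walker c i (i - 1)))"
    by (intro sum.cong) (auto simp: sum.distrib finite_jump_targets jump_targets_def)
  finally show ?thesis .
qed

text \<open>Rates depend on ranks, never on positions, and ranks stay between 0 and
  \<open>n\<close>. This caps the rates at each of the at most \<open>n\<close> occupied sites,
  however far the walkers spread.\<close>

definition total_rate_bound :: "real \<Rightarrow> real \<Rightarrow> nat \<Rightarrow> real" where
  "total_rate_bound \<beta> \<theta> n = real n * (exp \<theta> + exp (- \<theta> + real n * \<beta>))"

lemma sum_site_rates_le: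
  assumes \<beta>: "\<beta> > 0" and c: "c \<in> configurations n"
  shows "(\<Sum>i\<in>set_mset c. right_rate \<beta> \<theta> c i + left_rate \<beta> \<theta> c i) \<le> total_rate_bound \<beta> \<theta> n"
proof -
  let ?b = "exp \<theta> + exp (- \<theta> + real n * \<beta>)"
  have size: "size c = n" using c by (simp add: configurations_def)
  have "right_rate \<beta> \<theta> c i + left_rate \<beta> \<theta> c i \<le> ?b" for i
  proof (rule add_mono)
    have "right_rate \<beta> \<theta> c i \<le> exp \<theta> * (1 - 0)"
      unfolding right_rate_eq using \<beta> by (intro mult_left_mono diff_mono) auto
    then show "right_rate \<beta> \<theta> c i \<le> exp \<theta>" by simp
    have "left_rate \<beta> \<theta> c i \<le> exp (- \<theta>) * (exp (real n * \<beta>) - 0)"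
      unfolding left_rate_eq using \<beta> walkers_left_of_add_count_le[of c i] size
      by (intro mult_left_mono diff_mono) (auto intro!: mult_right_mono simp del: of_nat_add)
    then show "left_rate \<beta> \<theta> c i \<le> exp (- \<theta> + real n * \<beta>)" by (simp add: exp_add[symmetric])
  qed
  then have "(\<Sum>i\<in>set_mset c. right_rate \<beta> \<theta> c i + left_rate \<beta> \<theta> c i) \<le> real (card (set_mset c)) * ?b"
    using sum_bounded_above[of "set_mset c" "\<lambda>i. right_rate \<beta> \<theta> c i + left_rate \<beta> \<theta> c i" ?b] by simp
  also have "\<dots> \<le> real n * ?b"
    using card_length[of "sorted_list_of_multiset c"] size
    by (intro mult_right_mono) (auto simp: length_sorted_list_of_multiset)
  finally show ?thesis by (simp add: total_rate_bound_def)
qed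

section \<open>Drift of the gap weights\<close>

text \<open>If narrowing is \<open>exp \<beta>\<close> times as fast as widening, a weight
  multiplied by \<open>y\<close> per unit of gap has relative drift proportional to
  \<open>exp \<beta> * (1 / y - 1) + (y - 1)\<close>. This is negative for
  \<open>1 < y < exp \<beta>\<close> and smallest at \<open>y = exp (\<beta> / 2)\<close>, with
  value \<open>- (exp (\<beta> / 2) - 1)\<^sup>2\<close>.\<close>

definition gap_weight :: "real \<Rightarrow> nat \<Rightarrow> real multiset \<Rightarrow> real" where
  "gap_weight \<beta> r c = exp (\<beta> / 2 * gap c r)"

lemma gap_weight_add:
  assumes "gap c' r = gap c r + \<delta>"
  shows "gap_weight \<beta> r c' = gap_weight \<beta> r c * exp (\<beta> / 2 * \<delta>)"
  by (simp add: gap_weight_def assms exp_add[symmetric] distrib_left)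

definition contraction_rate :: "real \<Rightarrow> real" where
  "contraction_rate \<beta> = 2 * (1 - exp (- \<beta>)) * (exp (\<beta> / 2) - 1)\<^sup>2"

lemma contraction_rate_pos: "\<beta> > 0 \<Longrightarrow> 0 < contraction_rate \<beta>"
  by (simp add: contraction_rate_def)

definition site_drift :: "real \<Rightarrow> real \<Rightarrow> (real multiset \<Rightarrow> real) \<Rightarrow> real multiset \<Rightarrow> real \<Rightarrow> real" where
  "site_drift \<beta> \<theta> g c i = right_rate \<beta> \<theta> c i * (g (move_walker c i (i + 1)) - g c)
     + left_rate \<beta> \<theta> c i * (g (move_walker c i (i - 1)) - g c)"

text \<open>A closed gap cannot narrow, so contraction fails here. But a jump raises the weight from
  1 to at most \<open>exp (\<beta> / 2)\<close>, and the total rate is bounded.\<close>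

lemma gap_zero_drift:
  assumes \<beta>: "\<beta> > 0" and c: "c \<in> configurations n" and r: "Suc r < n" and gap0: "gap c r = 0"
  shows "(\<Sum>i\<in>set_mset c. site_drift \<beta> \<theta> (gap_weight \<beta> r) c i)
    \<le> total_rate_bound \<beta> \<theta> n * (exp (\<beta> / 2) - 1)"
proof -
  have "site_drift \<beta> \<theta> (gap_weight \<beta> r) c i
      \<le> (right_rate \<beta> \<theta> c i + left_rate \<beta> \<theta> c i) * (exp (\<beta> / 2) - 1)" if i: "i \<in># c" for i
  proof -
    have "gap (move_walker c i (i + 1)) r \<le> 1" "gap (move_walker c i (i - 1)) r \<le> 1"
      by (simp_all add: gap_move_right[OF c i r] gap_move_left[OF c i r] gap0)
    then have "gap_weight \<beta> r (move_walker c i (i + 1)) \<le> exp (\<beta> / 2)"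
      "gap_weight \<beta> r (move_walker c i (i - 1)) \<le> exp (\<beta> / 2)"
      using \<beta> by (simp_all add: gap_weight_def)
    moreover have "gap_weight \<beta> r c = 1" by (simp add: gap_weight_def gap0)
    ultimately show ?thesis
      unfolding site_drift_def distrib_right
      using right_rate_nonneg[OF \<beta>] left_rate_nonneg[OF \<beta>]
      by (intro add_mono mult_left_mono) auto
  qed
  then have "(\<Sum>i\<in>set_mset c. site_drift \<beta> \<theta> (gap_weight \<beta> r) c i)
      \<le> (\<Sum>i\<in>set_mset c. right_rate \<beta> \<theta> c i + left_rate \<beta> \<theta> c i) * (exp (\<beta> / 2) - 1)"
    unfolding sum_distrib_right by (rule sum_mono)
  also have "\<dots> \<le> total_rate_bound \<beta> \<theta> n * (exp (\<beta> / 2) - 1)"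
    using \<beta> by (intro mult_right_mono sum_site_rates_le c) auto
  finally show ?thesis .
qed

text \<open>Put \<open>A = exp (\<theta> - (r + 1) \<beta>)\<close>. Jumps from the left end of the gap narrow it at rate at least
  \<open>(exp \<beta> - 1) A\<close> and widen it at rate at most \<open>(1 - exp (- \<beta>)) / A\<close>; for the right end exchange
  \<open>A\<close> and \<open>1 / A\<close>. So narrowing is faster by a factor of at least \<open>exp \<beta>\<close>, and a weight
  that changes by the factor \<open>exp (\<beta> / 2)\<close> per jump contracts.\<close>

lemma gap_positive_drift:
  assumes \<beta>: "\<beta> > 0" and c: "c \<in> configurations n" and r: "Suc r < n" and gap: "gap c r > 0"
  shows "(\<Sum>i\<in>set_mset c. site_drift \<beta> \<theta> (gap_weight \<beta> r) c i)
    \<le> - contraction_rate \<beta> * gap_weight \<beta> r c"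
proof -
  define a where "a = position c r"
  define b where "b = position c (Suc r)"
  define z where "z = exp (\<beta> / 2)"
  define G where "G = gap_weight \<beta> r c"
  define A where "A = exp (\<theta> - real (Suc r) * \<beta>)"
  let ?D = "site_drift \<beta> \<theta> (gap_weight \<beta> r) c"
  let ?k = "walkers_left_of c"
  let ?s = "\<lambda>i. walkers_left_of c i + count c i"
  have size: "size c = n" using c by (simp add: configurations_def)
  have ab: "a < b" using gap by (simp add: gap_def a_def b_def)
  have a_in: "a \<in># c" and b_in: "b \<in># c"
    using r size by (auto simp: a_def b_def intro!: position_in)
  have z: "z > 1" using \<beta> by (simp add: z_def)
  have G: "G > 0" by (simp add: G_def gap_weight_def)
  have A: "A > 0" by (simp add: A_def)
  have z2: "exp \<beta> = z\<^sup>2" by (simp add: z_def power2_eq_square exp_add[symmetric])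
  have wider: "gap_weight \<beta> r c' = G * z" if "gap c' r = gap c r + 1" for c'
    using gap_weight_add[OF that] by (simp add: G_def z_def)
  have narrower: "gap_weight \<beta> r c' = G / z" if "gap c' r = gap c r - 1" for c'
    using gap_weight_add[of c' r c "- 1"] that by (simp add: G_def z_def exp_minus field_simps)
  have same: "gap_weight \<beta> r c' = G" if "gap c' r = gap c r" for c'
    using that by (simp add: G_def gap_weight_def)
  \<comment> \<open>As the gap is open, \<open>r\<close> is the last rank at \<open>a\<close> and
    \<open>Suc r\<close> the first at \<open>b\<close>. How many walkers share these sites is
    unknown, hence the two inequalities.\<close>
  have ka: "?k a \<le> r" and sa: "?s a = Suc r"
    using position_eq_iff[of r c a] position_le_iff[of "Suc r" c a] r size ab
    by (auto simp: a_def b_def simp del: add_Suc_right)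
  have kb: "?k b = Suc r" and sb: "Suc (Suc r) \<le> ?s b"
    using position_eq_iff[of "Suc r" c b] position_less_iff[of r c b] r size ab
    by (auto simp: a_def b_def)
  have A_right: "exp \<theta> * exp (- real (Suc r) * \<beta>) = A"
    unfolding A_def exp_add[symmetric] by (simp add: algebra_simps)
  have A_right': "exp \<theta> * exp (- real r * \<beta>) = A * z\<^sup>2"
    unfolding A_def z2[symmetric] exp_add[symmetric] by (simp add: algebra_simps)
  have A_right'': "exp \<theta> * exp (- real (Suc (Suc r)) * \<beta>) = A / z\<^sup>2"
    unfolding A_def z2[symmetric] exp_add[symmetric] exp_diff[symmetric] by (simp add: algebra_simps)
  have A_left: "exp (- \<theta>) * exp (real (Suc r) * \<beta>) = 1 / A"
    unfolding A_def exp_add[symmetric] by (simp add: exp_minus[symmetric] divide_inverse)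
  have A_left': "exp (- \<theta>) * exp (real r * \<beta>) = 1 / A / z\<^sup>2"
    unfolding A_left[symmetric] z2[symmetric] mult_exp_exp exp_diff[symmetric] by (simp add: algebra_simps)
  have A_left'': "exp (- \<theta>) * exp (real (Suc (Suc r)) * \<beta>) = 1 / A * z\<^sup>2"
    unfolding A_left[symmetric] z2[symmetric] mult_exp_exp by (simp add: algebra_simps)
  have zz: "G / z - G = - (G * (1 - 1 / z))" "G * z - G = G * (z - 1)" "0 \<le> G * (1 - 1 / z)" "0 \<le> G * (z - 1)"
    using z G by (auto simp: field_simps)
  have shrink: "0 \<le> x - x / z\<^sup>2" if "0 \<le> x" for x
  proof -
    have "x / z\<^sup>2 \<le> x / 1"
      using that z by (intro divide_left_mono one_le_power) auto
    then show ?thesis by simp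
  qed
  \<comment> \<open>A left jump from \<open>a\<close> moves the lowest rank there, so it widens this
    gap only if \<open>a\<close> holds a single walker. The right jump is at least as fast as for a
    single walker of rank \<open>r\<close>.\<close>
  have Da: "?D a \<le> - (A * z\<^sup>2 - A) * (G * (1 - 1 / z)) + (1 / A - 1 / A / z\<^sup>2) * (G * (z - 1))"
  proof -
    have "exp \<theta> * exp (- real r * \<beta>) \<le> exp \<theta> * exp (- real (?k a) * \<beta>)"
      using ka \<beta> by simp
    then have "A * z\<^sup>2 - A \<le> right_rate \<beta> \<theta> c a"
      unfolding right_rate_eq sa right_diff_distrib A_right A_right' by simp
    then have "- right_rate \<beta> \<theta> c a * (G * (1 - 1 / z)) \<le> - (A * z\<^sup>2 - A) * (G * (1 - 1 / z))"
      using zz(3) by (intro mult_right_mono) auto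
    moreover have "gap_weight \<beta> r (move_walker c a (a + 1)) = G / z"
      by (rule narrower) (simp only: gap_move_right[OF c a_in r] sa, simp)
    moreover have "left_rate \<beta> \<theta> c a * (gap_weight \<beta> r (move_walker c a (a - 1)) - G)
        \<le> (1 / A - 1 / A / z\<^sup>2) * (G * (z - 1))"
    proof (cases "?k a = r")
      case True
      have "gap_weight \<beta> r (move_walker c a (a - 1)) = G * z"
        by (rule wider) (simp add: gap_move_left[OF c a_in r] True)
      moreover have "left_rate \<beta> \<theta> c a = 1 / A - 1 / A / z\<^sup>2"
        unfolding left_rate_eq sa right_diff_distrib A_left by (simp only: True A_left')
      ultimately show ?thesis by (simp only: zz order_refl)
    next
      case False
      then have "gap_weight \<beta> r (move_walker c a (a - 1)) = G"
        using ka by (intro same) (simp add: gap_move_left[OF c a_in r])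
      moreover have "0 \<le> (1 / A - 1 / A / z\<^sup>2) * (G * (z - 1))"
        using A by (intro mult_nonneg_nonneg shrink zz(4)) simp
      ultimately show ?thesis by simp
    qed
    ultimately show ?thesis
      unfolding site_drift_def G_def[symmetric] by (simp add: zz(1))
  qed
  \<comment> \<open>Symmetrically, a right jump from \<open>b\<close> widens the gap only if
    \<open>b\<close> holds a single walker, and company at \<open>b\<close> only speeds up the
    narrowing left jump.\<close>
  have Db: "?D b \<le> (A - A / z\<^sup>2) * (G * (z - 1)) + - (1 / A * z\<^sup>2 - 1 / A) * (G * (1 - 1 / z))"
  proof -
    have "exp (- \<theta>) * exp (real (Suc (Suc r)) * \<beta>) \<le> exp (- \<theta>) * exp (real (?s b) * \<beta>)"
      using sb \<beta> by (intro mult_left_mono) (auto simp del: of_nat_add of_nat_Suc)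
    then have "1 / A * z\<^sup>2 - 1 / A \<le> left_rate \<beta> \<theta> c b"
      unfolding left_rate_eq kb right_diff_distrib A_left A_left'' by simp
    then have "- left_rate \<beta> \<theta> c b * (G * (1 - 1 / z)) \<le> - (1 / A * z\<^sup>2 - 1 / A) * (G * (1 - 1 / z))"
      using zz(3) by (intro mult_right_mono) auto
    moreover have "gap_weight \<beta> r (move_walker c b (b - 1)) = G / z"
      by (rule narrower) (simp add: gap_move_left[OF c b_in r] kb)
    moreover have "right_rate \<beta> \<theta> c b * (gap_weight \<beta> r (move_walker c b (b + 1)) - G)
        \<le> (A - A / z\<^sup>2) * (G * (z - 1))"
    proof (cases "?s b = Suc (Suc r)")
      case True
      have "gap_weight \<beta> r (move_walker c b (b + 1)) = G * z"
        by (rule wider) (simp only: gap_move_right[OF c b_in r] True, simp)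
      moreover have "right_rate \<beta> \<theta> c b = A - A / z\<^sup>2"
        unfolding right_rate_eq True right_diff_distrib A_right'' by (simp only: kb A_right)
      ultimately show ?thesis by (simp only: zz order_refl)
    next
      case False
      then have "gap_weight \<beta> r (move_walker c b (b + 1)) = G"
        using sb by (intro same) (simp only: gap_move_right[OF c b_in r], simp)
      moreover have "0 \<le> (A - A / z\<^sup>2) * (G * (z - 1))"
        using A by (intro mult_nonneg_nonneg shrink zz(4)) simp
      ultimately show ?thesis by simp
    qed
    ultimately show ?thesis
      unfolding site_drift_def G_def[symmetric] by (simp add: zz(1))
  qed
  have D0: "?D i = 0" if i: "i \<in> set_mset c - {a, b}" for i
  proof -
    have "?s i \<noteq> Suc r" "?s i \<noteq> Suc (Suc r)" "?k i \<noteq> r" "?k i \<noteq> Suc r"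
    proof -
      have cnt: "0 < count c i" using i by simp
      have "\<not> (?k i \<le> r \<and> r < ?s i)" "\<not> (?k i \<le> Suc r \<and> Suc r < ?s i)"
        using i position_eq_iff[of r c i] position_eq_iff[of "Suc r" c i] r size
        by (auto simp: a_def b_def)
      then show "?s i \<noteq> Suc r" "?s i \<noteq> Suc (Suc r)" "?k i \<noteq> r" "?k i \<noteq> Suc r"
        using cnt by linarith+
    qed
    moreover have "i \<in># c" using i by simp
    ultimately have "gap_weight \<beta> r (move_walker c i (i + 1)) = G"
      "gap_weight \<beta> r (move_walker c i (i - 1)) = G"
      by (auto intro!: same simp: gap_move_right[OF c _ r] gap_move_left[OF c _ r])
    then show ?thesis by (simp add: site_drift_def G_def)
  qed
  have "(\<Sum>i\<in>set_mset c. ?D i) = (\<Sum>i\<in>{a, b}. ?D i)"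
    using a_in b_in D0 by (intro sum.mono_neutral_right) auto
  also have "\<dots> = ?D a + ?D b" using ab by simp
  also have "\<dots> \<le> (- (A * z\<^sup>2 - A) * (G * (1 - 1 / z)) + (1 / A - 1 / A / z\<^sup>2) * (G * (z - 1)))
      + ((A - A / z\<^sup>2) * (G * (z - 1)) + - (1 / A * z\<^sup>2 - 1 / A) * (G * (1 - 1 / z)))"
    by (rule add_mono[OF Da Db])
  also have "\<dots> = - ((A + 1 / A) * ((1 - 1 / z\<^sup>2) * (z - 1)\<^sup>2 * G))"
  proof -
    \<comment> \<open>The narrowing term is \<open>z\<close> times the widening term, which leaves
      the factor \<open>1 - z\<close> overall. Free names \<open>y\<close>, \<open>w\<close>,
      \<open>B\<close> for \<open>1 / z\<close>, \<open>1 / z\<^sup>2\<close>, \<open>1 / A\<close>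
      make the remaining identity polynomial.\<close>
    have key: "(z\<^sup>2 - 1) * (1 - 1 / z) = z * ((1 - 1 / z\<^sup>2) * (z - 1))"
      using z by (simp add: field_simps power2_eq_square)
    have "- (A * z\<^sup>2 - A) * (G * (1 - y)) + (B - B * w) * (G * (z - 1))
        + ((A - A * w) * (G * (z - 1)) + - (B * z\<^sup>2 - B) * (G * (1 - y)))
      = - ((A + B) * ((1 - w) * (z - 1)\<^sup>2 * G))"
      if "(z\<^sup>2 - 1) * (1 - y) = z * ((1 - w) * (z - 1))" for B y w
      using that by algebra
    from this[OF key, of "1 / A"] show ?thesis
      by (simp only: times_divide_eq_right mult_1_right)
  qed
  also have "\<dots> \<le> - (2 * ((1 - 1 / z\<^sup>2) * (z - 1)\<^sup>2 * G))"
  proof -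
    \<comment> \<open>\<open>A\<close> carries all dependence on \<open>\<theta>\<close> and
      \<open>r\<close>. The bound \<open>A + 1 / A \<ge> 2\<close> removes it and is the origin of
      the 2 in \<open>contraction_rate\<close>.\<close>
    have "0 \<le> (A - 1)\<^sup>2 / A" using A by simp
    also have "(A - 1)\<^sup>2 / A = A + 1 / A - 2" using A by (simp add: field_simps power2_eq_square)
    finally have "2 \<le> A + 1 / A" by simp
    moreover have "0 \<le> (1 - 1 / z\<^sup>2) * (z - 1)\<^sup>2 * G"
      using z G by (intro mult_nonneg_nonneg) auto
    ultimately show ?thesis unfolding neg_le_iff_le by (rule mult_right_mono)
  qed
  also have "\<dots> = - contraction_rate \<beta> * G"
  proof -
    have "exp (- \<beta>) = 1 / z\<^sup>2" by (simp only: exp_minus z2 inverse_eq_divide)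
    then show ?thesis unfolding contraction_rate_def z_def[symmetric] by simp
  qed
  finally show ?thesis by (simp add: G_def)
qed

definition lyapunov :: "real \<Rightarrow> nat \<Rightarrow> real multiset \<Rightarrow> real" where
  "lyapunov \<beta> n c = (\<Sum>r<n - 1. gap_weight \<beta> r c)"

lemma lyapunov_nonneg: "0 \<le> lyapunov \<beta> n c"
  by (simp add: lyapunov_def gap_weight_def sum_nonneg)

text \<open>Each gap contributes the bound for a closed gap plus
  \<open>contraction_rate \<beta>\<close>, which compensates the contraction term at weight 1. Open
  and closed gaps then obey the same inequality.\<close>

definition drift_offset :: "real \<Rightarrow> real \<Rightarrow> nat \<Rightarrow> real" where
  "drift_offset \<beta> \<theta> n =
     real (n - 1) * (total_rate_bound \<beta> \<theta> n * (exp (\<beta> / 2) - 1) + contraction_rate \<beta>)"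

lemma drift_offset_nonneg:
  assumes "\<beta> > 0"
  shows "0 \<le> drift_offset \<beta> \<theta> n"
proof -
  have "0 \<le> total_rate_bound \<beta> \<theta> n" by (simp add: total_rate_bound_def)
  then show ?thesis
    using assms contraction_rate_pos[OF assms] by (simp add: drift_offset_def)
qed

lemma gap_weight_drift:
  assumes \<beta>: "\<beta> > 0" and c: "c \<in> configurations n" and r: "Suc r < n"
  shows "(\<Sum>i\<in>set_mset c. site_drift \<beta> \<theta> (gap_weight \<beta> r) c i)
    \<le> total_rate_bound \<beta> \<theta> n * (exp (\<beta> / 2) - 1) + contraction_rate \<beta>
      - contraction_rate \<beta> * gap_weight \<beta> r c"
proof (cases "gap c r = 0")
  case True
  then have "gap_weight \<beta> r c = 1" by (simp add: gap_weight_def)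
  then show ?thesis using gap_zero_drift[OF \<beta> c r True, of \<theta>] by simp
next
  case False
  then have "gap c r > 0" using gap_nonneg[OF c r] by simp
  moreover have "0 \<le> total_rate_bound \<beta> \<theta> n * (exp (\<beta> / 2) - 1)"
    using \<beta> by (simp add: total_rate_bound_def)
  ultimately show ?thesis
    using gap_positive_drift[OF \<beta> c r, of \<theta>] contraction_rate_pos[OF \<beta>] by simp
qed

text \<open>The generator is linear in the function, and each gap's bound holds whatever the other
  gaps are, so the bounds add up.\<close>

lemma lyapunov_drift:
  assumes \<beta>: "\<beta> > 0" and c: "c \<in> configurations n"
  shows "(\<Sum>c'\<in>jump_targets c. walker_rate \<beta> \<theta> c c' * (lyapunov \<beta> n c' - lyapunov \<beta> n c))
    \<le> drift_offset \<beta> \<theta> n - contraction_rate \<beta> * lyapunov \<beta> n c"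
proof -
  have "(\<Sum>c'\<in>jump_targets c. walker_rate \<beta> \<theta> c c' * (lyapunov \<beta> n c' - lyapunov \<beta> n c))
      = (\<Sum>i\<in>set_mset c. site_drift \<beta> \<theta> (lyapunov \<beta> n) c i)"
    unfolding site_drift_def by (rule sum_walker_rate)
  also have "\<dots> = (\<Sum>i\<in>set_mset c. \<Sum>r<n - 1. site_drift \<beta> \<theta> (gap_weight \<beta> r) c i)"
    by (simp only: site_drift_def lyapunov_def sum_subtractf[symmetric] sum_distrib_left sum.distrib)
  also have "\<dots> = (\<Sum>r<n - 1. \<Sum>i\<in>set_mset c. site_drift \<beta> \<theta> (gap_weight \<beta> r) c i)"
    by (rule sum.swap)
  also have "\<dots> \<le> (\<Sum>r<n - 1. total_rate_bound \<beta> \<theta> n * (exp (\<beta> / 2) - 1) + contraction_rate \<beta>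
      - contraction_rate \<beta> * gap_weight \<beta> r c)"
    by (intro sum_mono gap_weight_drift \<beta> c) auto
  also have "\<dots> = drift_offset \<beta> \<theta> n - contraction_rate \<beta> * lyapunov \<beta> n c"
    by (simp add: drift_offset_def lyapunov_def sum_subtractf sum_distrib_left)
  finally show ?thesis .
qed

section \<open>From the Lyapunov function to moments of the width\<close>

lemma powr_le_exp:
  fixes x p b :: real
  assumes "0 \<le> x" "0 < p" "0 < b"
  shows "x powr p \<le> (p / b) powr p * exp (b * x)"
proof -
  \<comment> \<open>The factorization prepares for \<open>y \<le> exp y\<close> at
    \<open>y = b * x / p\<close>, raised to the power \<open>p\<close>.\<close>
  have "x = (p / b) * (b * x / p)" using assms by simp
  then have "x powr p = ((p / b) * (b * x / p)) powr p" by simp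
  also have "\<dots> = (p / b) powr p * (b * x / p) powr p" by (rule powr_mult)
  also have "(b * x / p) powr p \<le> exp (b * x / p) powr p"
  proof (rule powr_mono2)
    show "b * x / p \<le> exp (b * x / p)"
      using exp_ge_add_one_self[of "b * x / p"] by linarith
  qed (use assms in auto)
  also have "exp (b * x / p) powr p = exp (b * x)" using assms by (simp add: exp_powr_real)
  finally show ?thesis using assms by (simp add: mult_left_mono)
qed

lemma width_eq_sum_gap:
  assumes c: "c \<in> configurations n" and n: "n \<ge> 1"
  shows "width c = (\<Sum>r<n - 1. gap c r)"
proof -
  have size: "size c = n" using c by (simp add: configurations_def)
  have set: "set_mset c = position c ` {..<n}"
    unfolding set_sorted_list_of_multiset[symmetric] position_def
    by (auto simp: set_conv_nth length_sorted_list_of_multiset size)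
  have "Max (set_mset c) = position c (n - 1)"
    unfolding set using n size by (intro Max_eqI) (auto intro!: position_mono)
  moreover have "Min (set_mset c) = position c 0"
    unfolding set using n size by (intro Min_eqI) (auto intro!: position_mono)
  ultimately show ?thesis
    by (simp add: width_def gap_def sum_lessThan_telescope)
qed

text \<open>The width is at most \<open>n\<close> times the largest gap, whose weight alone is one
  summand of \<open>lyapunov\<close>. A single walker has no gap, so that case is separate.\<close>

lemma width_powr_le_lyapunov:
  assumes \<beta>: "\<beta> > 0" and c: "c \<in> configurations n" and n: "n \<ge> 1" and p: "p > 0"
  shows "width c powr p \<le> (real n * (2 * p / \<beta>)) powr p * lyapunov \<beta> n c"
proof (cases "n = 1")
  case True
  then have "width c = 0" using width_eq_sum_gap[OF c n] by simp
  then show ?thesis using lyapunov_nonneg by simp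
next
  case False
  define m where "m = Max (gap c ` {..<n - 1})"
  have "m \<in> gap c ` {..<n - 1}" unfolding m_def using n False by (intro Max_in) (auto simp: lessThan_empty_iff)
  then obtain r where r: "r < n - 1" "gap c r = m" by auto
  have m: "0 \<le> m" using gap_nonneg[OF c, of r] r by simp
  have "width c \<le> real (n - 1) * m"
    unfolding width_eq_sum_gap[OF c n]
    using sum_bounded_above[of "{..<n - 1}" "gap c" m] by (simp add: m_def)
  also have "\<dots> \<le> real n * m" using m by (intro mult_right_mono) auto
  finally have "width c powr p \<le> (real n * m) powr p"
    using p gap_nonneg[OF c] by (intro powr_mono2) (auto simp: width_eq_sum_gap[OF c n] intro!: sum_nonneg)
  also have "\<dots> = real n powr p * m powr p" using m by (simp add: powr_mult)
  also have "\<dots> \<le> real n powr p * ((p / (\<beta> / 2)) powr p * exp (\<beta> / 2 * m))"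
    using powr_le_exp[of m p "\<beta> / 2"] m p \<beta> by (intro mult_left_mono) auto
  also have "\<dots> = (real n * (2 * p / \<beta>)) powr p * gap_weight \<beta> r c"
  proof -
    have "p / (\<beta> / 2) = 2 * p / \<beta>" by simp
    then show ?thesis by (simp only: powr_mult[of "real n"] gap_weight_def r mult.assoc)
  qed
  also have "\<dots> \<le> (real n * (2 * p / \<beta>)) powr p * lyapunov \<beta> n c"
    unfolding lyapunov_def using r
    by (intro mult_left_mono member_le_sum) (auto simp: gap_weight_def)
  finally show ?thesis .
qed

theorem lemma4p2:
  fixes \<beta> \<theta> p :: real and n :: nat
    and M :: "'w measure" and x0 :: "real multiset"
    and X :: "real \<Rightarrow> 'w \<Rightarrow> real multiset"
  assumes "\<beta> > 0" and "n \<ge> 1"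
    and "x0 \<in> configurations n"
    and "markov_jump_process M (configurations n) (walker_rate \<beta> \<theta>) x0 X"
    and "p \<ge> 1"
  shows "(SUP t\<in>{0..}. \<integral>\<^sup>+ \<omega>. ennreal (width (X t \<omega>) powr p) \<partial>M) < \<infinity>"
proof -
  define C where "C = (real n * (2 * p / \<beta>)) powr p"
  \<comment> \<open>Initial value plus the level \<open>K / c\<close> at which the drift bound
    changes sign; neither depends on \<open>t\<close>.\<close>
  define B where "B = lyapunov \<beta> n x0 + drift_offset \<beta> \<theta> n / contraction_rate \<beta>"
  have "(\<integral>\<^sup>+ \<omega>. ennreal (width (X t \<omega>) powr p) \<partial>M) \<le> ennreal C * ennreal B" if t: "t \<ge> 0" for t
  proof -
    have X: "X t \<in> measurable M (count_space (configurations n))"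
      using assms(4) t by (simp add: markov_jump_process_def)
    have "(\<integral>\<^sup>+ \<omega>. ennreal (width (X t \<omega>) powr p) \<partial>M)
        \<le> (\<integral>\<^sup>+ \<omega>. ennreal C * ennreal (lyapunov \<beta> n (X t \<omega>)) \<partial>M)"
    proof (rule nn_integral_mono)
      fix \<omega> assume "\<omega> \<in> space M"
      then have "X t \<omega> \<in> configurations n" using measurable_space[OF X] by simp
      then have "width (X t \<omega>) powr p \<le> C * lyapunov \<beta> n (X t \<omega>)"
        unfolding C_def using assms by (intro width_powr_le_lyapunov) auto
      then show "ennreal (width (X t \<omega>) powr p) \<le> ennreal C * ennreal (lyapunov \<beta> n (X t \<omega>))"
        by (simp add: C_def lyapunov_nonneg ennreal_leI flip: ennreal_mult)
    qed
    also have "\<dots> = ennreal C * (\<integral>\<^sup>+ \<omega>. ennreal (lyapunov \<beta> n (X t \<omega>)) \<partial>M)"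
      by (intro nn_integral_cmult measurable_compose[OF X]) simp
    also have "(\<integral>\<^sup>+ \<omega>. ennreal (lyapunov \<beta> n (X t \<omega>)) \<partial>M) \<le> ennreal B"
      unfolding B_def
    proof (rule markov_jump_process_lyapunov_bound[OF assms(4,3) _ finite_jump_targets jump_targets_subset
            _ _ lyapunov_nonneg contraction_rate_pos drift_offset_nonneg lyapunov_drift t])
      \<comment> \<open>The constant function 1 in \<open>sum_walker_rate\<close> turns the exit
        rate into the sum of the site rates.\<close>
      show "(\<Sum>c'\<in>jump_targets c. walker_rate \<beta> \<theta> c c') \<le> total_rate_bound \<beta> \<theta> n"
        if "c \<in> configurations n" for c
        using sum_site_rates_le[OF assms(1) that] sum_walker_rate[of \<beta> \<theta> c "\<lambda>_. 1"] by simp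
    qed (use assms in \<open>simp_all add: walker_rate_nonneg walker_rate_eq_0\<close>)
    finally show ?thesis by (simp add: mult_left_mono)
  qed
  then have "(SUP t\<in>{0..}. \<integral>\<^sup>+ \<omega>. ennreal (width (X t \<omega>) powr p) \<partial>M) \<le> ennreal C * ennreal B"
    by (intro SUP_least) simp
  also have "\<dots> < \<infinity>" by (simp add: ennreal_mult_less_top)
  finally show ?thesis .
qed

end
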